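(* Let $\lambda>0$, let $\{\hat N(t)\}_{t\ge0}$ be the renewal process with i.i.d. Gamma$(\lambda,2)$ interarrival times, let $\{Y_f(t)\}_{t\ge0}$ be the inverse of a Lévy subordinator with Bernstein function $f$, independent of $\{\hat N(t)\}_{t\ge0}$, and let $\bar N^f(t)=\hat N(Y_f(t))$, $t\ge0$. Then $\{\bar N^f(t)\}_{t\ge0}$ is a renewal process with i.i.d. waiting times $\{J_n\}_{n\ge1}$ that satisfy $$\Pr\{J_n>t\}=\mathbb E\big((1+\lambda Y_f(t))e^{-\lambda Y_f(t)}\big),\qquad t\ge 0.$$
   Context: Gamma$(\lambda,2)$ is the distribution with density $\lambda^2xe^{-\lambda x}$, $x>0$, i.e. with tail $\Pr\{W>x\}=(1+\lambda x)e^{-\lambda x}$. Thus $\hat N(t)=\max\{n\ge0:W_1+\cdots+W_n\le t\}$ with $W_i$ i.i.d. Gamma$(\lambda,2)$, and $\Pr\{\hat N(t)=n\}=e^{-\lambda t}\left(\frac{(\lambda t)^{2n}}{(2n)!}+\frac{(\lambda t)^{2n+1}}{(2n+1)!}\right)$, $n\ge0$. A Lévy subordinator $\{D_f(t)\}_{t\ge0}$ is a one-dimensional Lévy process with non-decreasing paths, $D_f(0)=0$ a.s., and $\mathbb E(e^{-sD_f(t)})=e^{-tf(s)}$, $s>0$, where $f(s)=cs+\int_0^\infty(1-e^{-sx})\bar\nu(\mathrm dx)$ is its Bernstein function ($c\ge0$, $\int_0^\infty(x\wedge1)\bar\nu(\mathrm dx)<\infty$). Its inverse is $Y_f(t)=\inf\{x\ge0:D_f(x)>t\}$,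 $t\ge0$. *)

theory Defs
  imports "HOL-Probability.Probability"
begin

text \<open>Sequences of waiting times are indexed from 0, so \<open>W i\<close> is the waiting time usually
  written with index \<open>i + 1\<close>.\<close>

definition renewal_count :: "(nat \<Rightarrow> 'a \<Rightarrow> real) \<Rightarrow> real \<Rightarrow> 'a \<Rightarrow> nat" where
  "renewal_count W t \<omega> = Max {n. (\<Sum>i<n. W i \<omega>) \<le> t}"

definition (in prob_space) iid :: "(nat \<Rightarrow> 'a \<Rightarrow> real) \<Rightarrow> bool" where
  "iid W \<longleftrightarrow> indep_vars (\<lambda>_. borel) W UNIV \<and> (\<forall>i. distr M borel (W i) = distr M borel (W 0))"

text \<open>Waiting times may vanish with positive probability, but not almost surely (so that the
  maximum defining the counting process exists almost surely). This generality is needed: if the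
  subordinator below is a compound Poisson process, the time-changed process has several
  simultaneous renewals with positive probability.\<close>

definition (in prob_space) renewal_process ::
    "(real \<Rightarrow> 'a \<Rightarrow> nat) \<Rightarrow> (nat \<Rightarrow> 'a \<Rightarrow> real) \<Rightarrow> bool" where
  "renewal_process N J \<longleftrightarrow>
     (\<forall>t\<ge>0. random_variable (count_space UNIV) (N t)) \<and>
     iid J \<and>
     (AE \<omega> in M. \<forall>i. 0 \<le> J i \<omega>) \<and>
     prob {\<omega> \<in> space M. J 0 \<omega> = 0} < 1 \<and>
     (AE \<omega> in M. \<forall>t\<ge>0. N t \<omega> = renewal_count J t \<omega>)"

definition (in prob_space) levy_process :: "(real \<Rightarrow> 'a \<Rightarrow> real) \<Rightarrow> bool" where
  "levy_process X \<longleftrightarrow>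
     (\<forall>t\<ge>0. random_variable borel (X t)) \<and>
     (AE \<omega> in M. X 0 \<omega> = 0) \<and>
     (\<forall>(n::nat) u. 0 \<le> u 0 \<longrightarrow> (\<forall>i<n. u i \<le> u (Suc i)) \<longrightarrow>
        indep_vars (\<lambda>_. borel) (\<lambda>i \<omega>. X (u (Suc i)) \<omega> - X (u i) \<omega>) {..<n}) \<and>
     (\<forall>s\<ge>0. \<forall>t\<ge>0. distr M borel (\<lambda>\<omega>. X (s + t) \<omega> - X s \<omega>) = distr M borel (X t)) \<and>
     (\<forall>t\<ge>0. \<forall>\<epsilon>>0.
        ((\<lambda>s. prob {\<omega> \<in> space M. \<epsilon> < \<bar>X s \<omega> - X t \<omega>\<bar>}) \<longlongrightarrow> 0) (at t within {0..})) \<and>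
     (AE \<omega> in M. \<forall>t\<ge>0.
        continuous (at_right t) (\<lambda>s. X s \<omega>) \<and>
        (0 < t \<longrightarrow> (\<exists>l. ((\<lambda>s. X s \<omega>) \<longlongrightarrow> l) (at_left t))))"

definition bernstein_function :: "(real \<Rightarrow> real) \<Rightarrow> bool" where
  "bernstein_function f \<longleftrightarrow>
     (\<exists>c (\<nu> :: real measure).
        0 \<le> c \<and> sets \<nu> = sets borel \<and>
        (\<integral>\<^sup>+x\<in>{0<..}. ennreal (min x 1) \<partial>\<nu>) < \<infinity> \<and>
        (\<forall>s>0. f s = c * s + (LINT x:{0<..}|\<nu>. 1 - exp (- s * x))))"

definition (in prob_space) levy_subordinator ::
    "(real \<Rightarrow> real) \<Rightarrow> (real \<Rightarrow> 'a \<Rightarrow> real) \<Rightarrow> bool" where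
  "levy_subordinator f D \<longleftrightarrow>
     bernstein_function f \<and>
     levy_process D \<and>
     (AE \<omega> in M. mono_on {0..} (\<lambda>t. D t \<omega>)) \<and>
     (\<forall>t\<ge>0. \<forall>s>0. expectation (\<lambda>\<omega>. exp (- s * D t \<omega>)) = exp (- t * f s))"

text \<open>For a subordinator with nonzero Bernstein function the set below is almost surely nonempty
  for all \<open>t\<close>; for \<open>f = 0\<close> it is empty, and the infimum is an unspecified real number.\<close>

definition inverse_process :: "(real \<Rightarrow> 'a \<Rightarrow> real) \<Rightarrow> real \<Rightarrow> 'a \<Rightarrow> real" where
  "inverse_process D t \<omega> = Inf {x. 0 \<le> x \<and> D x \<omega> > t}"

definition generated_events :: "'a measure \<Rightarrow> 'b measure \<Rightarrow> (real \<Rightarrow> 'a \<Rightarrow> 'b) \<Rightarrow> 'a set set" where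
  "generated_events M S X =
     sigma_sets (space M) {X t -` A \<inter> space M | t A. 0 \<le> t \<and> A \<in> sets S}"

text \<open>The independence predicate for sets of events includes that both are contained in the
  events of the probability space, so all \<open>X t\<close> and \<open>Y t\<close> with \<open>0 \<le> t\<close> are random variables.
  The predicate for pairs of random variables is not applicable, because it requires both to have
  values in the same type.\<close>

definition (in prob_space) indep_processes ::
    "'b measure \<Rightarrow> (real \<Rightarrow> 'a \<Rightarrow> 'b) \<Rightarrow> 'c measure \<Rightarrow> (real \<Rightarrow> 'a \<Rightarrow> 'c) \<Rightarrow> bool" where
  "indep_processes S X T Y \<longleftrightarrow> indep_set (generated_events M S X) (generated_events M T Y)"

end

theory Submission
  imports Defs
begin

text \<open>
  Let \<open>S n\<close> be the \<open>n\<close>-th renewal time of \<open>N\<close>, that is, the sum of the first \<open>n\<close> waiting times, and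
  let \<open>Y\<close> be the right inverse of the subordinator \<open>D\<close>. Then \<open>S n \<le> Y t\<close> means that \<open>D x \<le> t\<close> for
  all \<open>x\<close> below \<open>S n\<close>, that is, \<open>T n \<le> t\<close>, where \<open>T n\<close> is the left limit of \<open>D\<close> at \<open>S n\<close>
  (\<open>le_right_inverse_iff\<close>). So the time-changed process counts the points \<open>T n\<close>, and its waiting
  times \<open>J n = T (Suc n) - T n\<close> are the increments of \<open>D\<close> over intervals of the lengths \<open>W n\<close>.

  Given the waiting times \<open>W\<close>, these increments are independent, because \<open>D\<close> is a Levy process, and
  the law of \<open>J n\<close> is that of \<open>D\<close> at time \<open>W n\<close>; by stochastic continuity left limits at fixed
  times make no difference. Averaging over the i.i.d. sequence \<open>W\<close> gives
  \<open>E (\<Prod>i<n. g i (J i)) = (\<Prod>i<n. E (h i (W 0)))\<close> with \<open>h i w = E (g i (D w))\<close>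
  (\<open>expectation_prod_J\<close>), and such a product formula for bounded Lipschitz functions \<open>g i\<close> forces
  the \<open>J i\<close> to be i.i.d. (\<open>iid_if_expectation_prod\<close>). For the conditioning, \<open>S\<close> is
  first rounded down to a grid, so that only countably many times are involved
  (\<open>expectation_prod_grid_increments\<close>); then the grid is refined.

  The hypothesis makes \<open>N\<close> and \<open>Y\<close> independent, rather than \<open>W\<close> and \<open>D\<close>. But \<open>S n\<close> is the first
  time at which \<open>N\<close> reaches \<open>n\<close>, and \<open>D x\<close> is the first time at which \<open>Y\<close> exceeds \<open>x\<close>, so both
  can be recovered almost surely from the independent processes. This uses that \<open>D\<close> and \<open>S\<close> are
  unbounded, which follows from their Laplace transforms.

  Finally, \<open>J 0 > t\<close> is the event that \<open>W 0 > Y t\<close>, whose probability is the mean of the tail of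
  \<open>W 0\<close> at the independent level \<open>Y t\<close> (\<open>prob_J_greater\<close>).
\<close>

section \<open>First passage over rational times\<close>

text \<open>The infimum runs over the rational times only, so that it is measurable as soon as each single
  event is.\<close>
definition first_passage :: "(real \<Rightarrow> bool) \<Rightarrow> real" where
  "first_passage P = Inf {q\<in>\<rat>. 0 \<le> q \<and> P q}"

lemma first_passage_eqI:
  assumes "0 \<le> a" "\<And>q. a < q \<Longrightarrow> P q" "\<And>q. 0 \<le> q \<Longrightarrow> P q \<Longrightarrow> a \<le> q"
  shows "first_passage P = a"
proof -
  let ?A = "{q\<in>\<rat>. 0 \<le> q \<and> P q}"
  have small: "\<exists>q\<in>?A. q < b" if ab: "a < b" for b
  proof -
    obtain q where q: "q \<in> \<rat>" "a < q" "q < b" using Rats_dense_in_real[OF ab] by blast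
    have "P q" using q(2) by (rule assms(2))
    then show ?thesis using q assms(1) by (intro bexI[of _ q]) simp_all
  qed
  have ne: "?A \<noteq> {}"
  proof -
    have "\<exists>q\<in>?A. q < a + 1" by (rule small) simp
    then show ?thesis by blast
  qed
  have bdd: "bdd_below ?A" by (rule bdd_belowI[of _ 0]) simp
  have "a \<le> Inf ?A" using ne by (rule cInf_greatest) (simp add: assms(3))
  moreover have "Inf ?A \<le> a"
  proof (rule ccontr)
    assume "\<not> Inf ?A \<le> a"
    then obtain q where q: "q \<in> ?A" "q < Inf ?A" using small[of "Inf ?A"] by (auto simp only: not_le)
    show False using cInf_lower[OF q(1) bdd] q(2) by simp
  qed
  ultimately show ?thesis by (simp add: first_passage_def)
qed

text \<open>The infimum of the empty set is an unspecified constant, which accounts for the second,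
  conditional event in the decomposition.\<close>
lemma measurable_first_passage:
  assumes "\<And>q. 0 \<le> q \<Longrightarrow> {\<omega>\<in>space M. P q \<omega>} \<in> sets M"
  shows "(\<lambda>\<omega>. first_passage (\<lambda>q. P q \<omega>)) \<in> borel_measurable M"
proof (rule borel_measurableI_less)
  fix a :: real
  let ?A = "\<lambda>\<omega>. {q\<in>\<rat>. 0 \<le> q \<and> P q \<omega>}"
  let ?Q = "{q\<in>\<rat>. 0 \<le> (q::real)}"
  have c: "countable ?Q" "countable {q\<in>?Q. q < a}"
    by (rule countable_subset[OF _ countable_rat], auto)+
  have less: "first_passage (\<lambda>q. P q \<omega>) < a \<longleftrightarrow>
      (\<exists>q\<in>?A \<omega>. q < a) \<or> (Inf {} < a \<and> (\<forall>q\<in>?Q. \<not> P q \<omega>))" for \<omega>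
  proof (cases "?A \<omega> = {}")
    case True
    then have "first_passage (\<lambda>q. P q \<omega>) = Inf {}" by (simp only: first_passage_def)
    moreover have "\<forall>q\<in>?Q. \<not> P q \<omega>" using True by simp
    ultimately show ?thesis by (simp add: True)
  next
    case False
    have "bdd_below (?A \<omega>)" by (rule bdd_belowI[of _ 0]) simp
    then have "first_passage (\<lambda>q. P q \<omega>) < a \<longleftrightarrow> (\<exists>q\<in>?A \<omega>. q < a)"
      unfolding first_passage_def by (rule cInf_less_iff[OF False])
    moreover have "\<not> (\<forall>q\<in>?Q. \<not> P q \<omega>)" using False by blast
    ultimately show ?thesis by (simp only: simp_thms)
  qed
  have "{\<omega>\<in>space M. first_passage (\<lambda>q. P q \<omega>) < a} =
    (\<Union>q\<in>{q\<in>?Q. q < a}. {\<omega>\<in>space M. P q \<omega>}) \<union>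
    (if Inf {} < a then space M - (\<Union>q\<in>?Q. {\<omega>\<in>space M. P q \<omega>}) else {})" (is "?L = ?R")
    unfolding less by (cases "Inf {} < a") auto
  also have "?R \<in> sets M"
  proof -
    have "(\<Union>q\<in>B. {\<omega>\<in>space M. P q \<omega>}) \<in> sets M" if "countable B" "B \<subseteq> ?Q" for B
      by (rule sets.countable_UN'[OF \<open>countable B\<close>]) (use assms that in auto)
    from this[OF c(1) subset_refl] this[OF c(2) Collect_subset] show ?thesis by simp
  qed
  finally show "{\<omega>\<in>space M. first_passage (\<lambda>q. P q \<omega>) < a} \<in> sets M" .
qed

section \<open>The right inverse of a nondecreasing path\<close>

definition right_inverse :: "(real \<Rightarrow> real) \<Rightarrow> real \<Rightarrow> real" where
  "right_inverse d t = Inf {x. 0 \<le> x \<and> t < d x}"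

text \<open>For a nondecreasing path starting in 0 this is the left limit of the path at \<open>s\<close> if \<open>0 < s\<close>, and
  0 if \<open>s = 0\<close>.\<close>
definition left_sup :: "(real \<Rightarrow> real) \<Rightarrow> real \<Rightarrow> real" where
  "left_sup d s = Sup (insert 0 (d ` {0..<s}))"

locale subordinator_path =
  fixes d :: "real \<Rightarrow> real"
  assumes start: "d 0 = 0"
    and mono: "mono_on {0..} d"
    and right_cont: "\<And>x. 0 \<le> x \<Longrightarrow> continuous (at_right x) d"
    and unbounded: "\<And>t. \<exists>x\<ge>0. t < d x"
begin

lemma d_mono: "0 \<le> a \<Longrightarrow> a \<le> b \<Longrightarrow> d a \<le> d b"
  using mono by (auto simp: mono_on_def)

lemma d_nonneg: "0 \<le> a \<Longrightarrow> 0 \<le> d a"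
  using d_mono[of 0 a] start by simp

lemma right_inverse_le: "0 \<le> x \<Longrightarrow> t < d x \<Longrightarrow> right_inverse d t \<le> x"
  unfolding right_inverse_def by (intro cInf_lower) (auto intro: bdd_belowI[of _ 0])

lemma le_right_inverse: "s \<le> right_inverse d t" if "\<And>x. 0 \<le> x \<Longrightarrow> x < s \<Longrightarrow> d x \<le> t"
  unfolding right_inverse_def using unbounded[of t] that by (intro cInf_greatest) force+

lemma right_inverse_nonneg: "0 \<le> right_inverse d t"
  by (rule le_right_inverse) auto

lemma bdd_left: "bdd_above (insert 0 (d ` {0..<s}))"
  by (intro bdd_aboveI[of _ "max 0 (d s)"]) (auto intro: d_mono simp: le_max_iff_disj)

lemma left_sup_le_iff: "left_sup d s \<le> t \<longleftrightarrow> 0 \<le> t \<and> (\<forall>x. 0 \<le> x \<and> x < s \<longrightarrow> d x \<le> t)"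
  unfolding left_sup_def using bdd_left by (subst cSup_le_iff) auto

lemma left_sup_nonneg: "0 \<le> left_sup d s"
  using left_sup_le_iff[of s "left_sup d s"] by auto

lemma d_le_left_sup: "0 \<le> x \<Longrightarrow> x < s \<Longrightarrow> d x \<le> left_sup d s"
  using left_sup_le_iff[of s "left_sup d s"] by auto

lemma left_sup_mono: "a \<le> b \<Longrightarrow> left_sup d a \<le> left_sup d b"
  using left_sup_le_iff[of a "left_sup d b"] d_le_left_sup[of _ b] left_sup_nonneg[of b] by auto

lemma left_sup_0: "left_sup d 0 = 0"
  by (simp add: left_sup_def)

text \<open>The Galois connection between a path and its right inverse: \<open>s \<le> right_inverse d t\<close> says that no
  point before \<open>s\<close> has a value above \<open>t\<close>. It turns an arrival at the clock time \<open>s\<close> into an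
  arrival at the real time \<open>left_sup d s\<close>.\<close>
lemma le_right_inverse_iff:
  assumes "0 \<le> t" shows "s \<le> right_inverse d t \<longleftrightarrow> left_sup d s \<le> t"
proof
  assume s: "s \<le> right_inverse d t"
  have "d x \<le> t" if "0 \<le> x" "x < s" for x
    using right_inverse_le[of x t] that s by (cases "t < d x") auto
  then show "left_sup d s \<le> t" using assms by (simp add: left_sup_le_iff)
qed (rule le_right_inverse, simp add: left_sup_le_iff)

lemma first_passage_right_inverse: "first_passage (\<lambda>q. s \<le> right_inverse d q) = left_sup d s"
proof (rule first_passage_eqI)
  show "s \<le> right_inverse d q" if "left_sup d s < q" for q
    using that le_right_inverse_iff[of q s] left_sup_nonneg[of s] by auto
qed (use le_right_inverse_iff left_sup_nonneg in auto)

text \<open>A right-continuous path can be read off its inverse: \<open>d x < q\<close> implies \<open>x < right_inverse d q\<close>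
  by right-continuity, and this implies \<open>d x \<le> q\<close>. Hence independence of the inverse
  process carries over to the subordinator.\<close>
lemma first_passage_recovers_path: "0 \<le> x \<Longrightarrow> first_passage (\<lambda>q. x < right_inverse d q) = d x"
proof (rule first_passage_eqI)
  assume x: "0 \<le> x"
  show "0 \<le> d x" using d_nonneg x .
  show "x < right_inverse d q" if "d x < q" for q
  proof -
    have "(d \<longlongrightarrow> d x) (at_right x)"
      using right_cont[OF x] by (simp add: continuous_within)
    then have "\<forall>\<^sub>F z in at_right x. d z < q"
      using that by (rule order_tendstoD)
    then obtain b where b: "x < b" "\<And>z. x < z \<Longrightarrow> z < b \<Longrightarrow> d z < q"
      unfolding eventually_at_right_field by auto
    have "(x + b) / 2 \<le> right_inverse d q"
    proof (rule le_right_inverse)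
      fix z assume "0 \<le> z" "z < (x + b) / 2"
      then have "d z \<le> d ((x + b) / 2)" using x b by (intro d_mono) auto
      also have "\<dots> < q" using b x by (intro b) auto
      finally show "d z \<le> q" by simp
    qed
    then show ?thesis using b by simp
  qed
  show "d x \<le> q" if "x < right_inverse d q" for q
    using that right_inverse_le[OF x, of q] by force
qed

end

section \<open>Approximation of time points from below\<close>

text \<open>The grid point assigned to \<open>s > 0\<close> is the largest multiple of \<open>1 / Suc k\<close> strictly below \<open>s\<close>. It has to
  be strictly below, so that a path evaluated there approaches its left limit.\<close>
definition grid :: "nat \<Rightarrow> real \<Rightarrow> nat" where
  "grid k s = nat (\<lceil>real (Suc k) * s\<rceil> - 1)"

abbreviation grid_point :: "nat \<Rightarrow> real \<Rightarrow> real" where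
  "grid_point k s \<equiv> real (grid k s) / real (Suc k)"

lemma measurable_grid [measurable]: "grid k \<in> borel \<rightarrow>\<^sub>M count_space UNIV"
  unfolding grid_def by measurable

lemma grid_mono: "a \<le> b \<Longrightarrow> grid k a \<le> grid k b"
  unfolding grid_def by (intro nat_mono diff_mono ceiling_mono mult_left_mono) auto

lemma grid_point_less: assumes "0 < s" shows "grid_point k s < s"
proof -
  have "0 < real (Suc k) * s" using assms by simp
  then have "real (grid k s) = of_int \<lceil>real (Suc k) * s\<rceil> - 1"
    unfolding grid_def by (subst of_nat_nat) (auto simp: le_diff_eq one_le_ceiling simp del: of_nat_Suc)
  also have "\<dots> < real (Suc k) * s" by linarith
  finally show ?thesis by (simp add: divide_less_eq mult.commute del: of_nat_Suc)
qed

lemma grid_point_tendsto: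
  assumes "0 \<le> s" shows "(\<lambda>k. grid_point k s) \<longlonglongrightarrow> s"
proof (rule real_tendsto_sandwich)
  show "\<forall>\<^sub>F k in sequentially. s - 1 / real (Suc k) \<le> grid_point k s"
  proof (rule always_eventually, rule allI)
    fix k
    have "real (Suc k) * s - 1 \<le> real (grid k s)" unfolding grid_def by linarith
    then have "(real (Suc k) * s - 1) / real (Suc k) \<le> grid_point k s" by (intro divide_right_mono) auto
    then show "s - 1 / real (Suc k) \<le> grid_point k s" by (simp add: diff_divide_distrib del: of_nat_Suc)
  qed
  show "\<forall>\<^sub>F k in sequentially. grid_point k s \<le> s"
    using grid_point_less[of s] assms
    by (cases "s = 0") (simp_all add: grid_def less_imp_le del: of_nat_Suc)
  show "(\<lambda>k. s - 1 / real (Suc k)) \<longlonglongrightarrow> s"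
    using tendsto_diff[OF tendsto_const[of s] LIMSEQ_inverse_real_of_nat] by (simp add: inverse_eq_divide)
qed simp

lemma (in subordinator_path) grid_tendsto_left_sup:
  assumes "0 \<le> s" shows "(\<lambda>k. d (grid_point k s)) \<longlonglongrightarrow> left_sup d s"
proof (cases "s = 0")
  case True
  then show ?thesis by (simp add: grid_def start left_sup_0)
next
  case False
  with assms have s: "0 < s" by simp
  show ?thesis
  proof (rule order_tendstoI)
    fix a assume "a < left_sup d s"
    then have "\<not> left_sup d s \<le> a" by simp
    then consider "a < 0" | x where "0 \<le> x" "x < s" "a < d x"
      unfolding left_sup_le_iff by force
    then show "\<forall>\<^sub>F k in sequentially. a < d (grid_point k s)"
    proof cases
      case 1
      then show ?thesis
        by (intro always_eventually allI less_le_trans[OF 1] d_nonneg) simp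
    next
      case 2
      have "\<forall>\<^sub>F k in sequentially. x < grid_point k s"
        using order_tendstoD(1)[OF grid_point_tendsto[OF assms] \<open>x < s\<close>] .
      then show ?thesis
        by eventually_elim (use 2 in \<open>auto intro!: less_le_trans[OF \<open>a < d x\<close>] d_mono simp del: of_nat_Suc\<close>)
    qed
  next
    fix a assume "left_sup d s < a"
    then show "\<forall>\<^sub>F k in sequentially. d (grid_point k s) < a"
      by (intro always_eventually allI le_less_trans[OF d_le_left_sup]) (auto intro: grid_point_less[OF s] simp del: of_nat_Suc)
  qed
qed

section \<open>Renewal times and counting processes\<close>

text \<open>Unboundedness makes the set finite, so that its maximum is attained and not an unspecified number.\<close>
lemma le_Max_iff_unbounded:
  fixes s :: "nat \<Rightarrow> real"
  assumes "incseq s" "s 0 \<le> t" "\<exists>n. t < s n"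
  shows "n \<le> Max {n. s n \<le> t} \<longleftrightarrow> s n \<le> t"
proof -
  obtain m where m: "t < s m" using assms by auto
  have "{n. s n \<le> t} \<subseteq> {..<m}"
  proof safe
    fix k assume "s k \<le> t"
    then show "k < m" using m incseqD[OF assms(1), of m k] by (cases "k < m") auto
  qed
  then have "finite {n. s n \<le> t}" by (rule finite_subset) simp
  then show ?thesis
    using assms(2) incseqD[OF assms(1)] by (subst Max_ge_iff) (auto intro: order_trans)
qed

lemma first_passage_Max:
  fixes s :: "nat \<Rightarrow> real"
  assumes "incseq s" "s 0 = 0" "\<And>t. \<exists>n. t < s n"
  shows "first_passage (\<lambda>q. n \<le> Max {n. s n \<le> q}) = s n"
proof (rule first_passage_eqI)
  show "0 \<le> s n" using incseqD[OF assms(1), of 0 n] assms(2) by simp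
  then show "n \<le> Max {n. s n \<le> q}" if "s n < q" for q
    using that le_Max_iff_unbounded[of s q n] assms by auto
  show "s n \<le> q" if "0 \<le> q" "n \<le> Max {n. s n \<le> q}" for q
    using that le_Max_iff_unbounded[of s q n] assms by auto
qed

text \<open>The maximum of an infinite or empty set is an unspecified constant, so these two cases are split
  off.\<close>
lemma measurable_Max_le:
  fixes S :: "nat \<Rightarrow> 'a \<Rightarrow> real"
  assumes [measurable]: "\<And>n. S n \<in> borel_measurable M" "Y \<in> borel_measurable M"
  shows "(\<lambda>\<omega>. Max {n. S n \<omega> \<le> Y \<omega>}) \<in> M \<rightarrow>\<^sub>M count_space (UNIV :: nat set)"
proof -
  have fin: "finite {n. S n \<omega> \<le> Y \<omega>} \<longleftrightarrow> (\<exists>m. \<forall>n\<ge>m. \<not> S n \<omega> \<le> Y \<omega>)" for \<omega>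
    unfolding finite_nat_set_iff_bounded by (intro arg_cong[where f = Ex] ext) (metis mem_Collect_eq not_le)
  have eq: "Max {n. S n \<omega> \<le> Y \<omega>} = k \<longleftrightarrow>
     (if (\<exists>m. \<forall>n\<ge>m. \<not> S n \<omega> \<le> Y \<omega>) then
        (if \<exists>n. S n \<omega> \<le> Y \<omega> then S k \<omega> \<le> Y \<omega> \<and> (\<forall>n. S n \<omega> \<le> Y \<omega> \<longrightarrow> n \<le> k) else Max {} = k)
      else the None = k)" for \<omega> k
  proof (cases "finite {n. S n \<omega> \<le> Y \<omega>}")
    case True
    then show ?thesis
      using Max_eq_iff[OF True, of k] by (cases "{n. S n \<omega> \<le> Y \<omega>} = {}") (auto simp flip: fin)
  next
    case False
    then show ?thesis using Max.infinite[OF False] by (simp flip: fin)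
  qed
  show ?thesis
    by (subst measurable_count_space_eq2_countable) (auto simp: vimage_def Int_def conj_commute eq)
qed

section \<open>Laplace transforms and unbounded paths\<close>

text \<open>If \<open>X n \<le> m\<close> for all \<open>n\<close> has probability \<open>p\<close>, then \<open>p * exp (- m)\<close> is at most every
  expectation of \<open>exp (- X n)\<close>, and these tend to 0. The criterion serves both the
  subordinator and the partial sums of the waiting times.\<close>
lemma (in prob_space) AE_unbounded_if_laplace_vanishes:
  fixes X :: "nat \<Rightarrow> 'a \<Rightarrow> real"
  assumes [measurable]: "\<And>n. X n \<in> borel_measurable M"
    and int: "\<And>n. integrable M (\<lambda>\<omega>. exp (- X n \<omega>))"
    and lim: "(\<lambda>n. expectation (\<lambda>\<omega>. exp (- X n \<omega>))) \<longlonglongrightarrow> 0"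
  shows "AE \<omega> in M. \<forall>t. \<exists>n. t < X n \<omega>"
proof -
  have "AE \<omega> in M. \<exists>n. real m < X n \<omega>" for m :: nat
  proof -
    let ?A = "{\<omega>\<in>space M. \<forall>n. X n \<omega> \<le> real m}"
    have bound: "prob ?A \<le> exp (real m) * expectation (\<lambda>\<omega>. exp (- X n \<omega>))" for n
    proof -
      have "prob ?A \<le> prob {\<omega>\<in>space M. exp (- real m) \<le> exp (- X n \<omega>)}"
        by (rule finite_measure_mono) auto
      also have "\<dots> \<le> expectation (\<lambda>\<omega>. exp (- X n \<omega>)) / exp (- real m)"
        by (rule integral_Markov_inequality_measure[OF int, where A = "{}"]) auto
      finally show ?thesis by (simp add: exp_minus field_simps)
    qed
    have "(\<lambda>n. exp (real m) * expectation (\<lambda>\<omega>. exp (- X n \<omega>))) \<longlonglongrightarrow> 0"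
      using tendsto_mult_right_zero[OF lim] .
    then have "prob ?A \<le> 0"
      by (rule LIMSEQ_le_const) (use bound in blast)
    then have "prob ?A = 0" by (simp add: measure_le_0_iff)
    then have "AE \<omega> in M. \<omega> \<notin> ?A"
      by (subst (asm) prob_eq_0) auto
    with AE_space show ?thesis by eventually_elim (auto simp: not_le)
  qed
  then have "AE \<omega> in M. \<forall>m::nat. \<exists>n. real m < X n \<omega>" by (subst AE_all_countable) blast
  then show ?thesis
  proof eventually_elim
    case (elim \<omega>)
    show ?case
    proof
      fix t
      obtain m :: nat where "t < real m" using reals_Archimedean2 by blast
      moreover obtain n where "real m < X n \<omega>" using elim by blast
      ultimately show "\<exists>n. t < X n \<omega>" by (blast intro: less_trans)
    qed
  qed
qed

section \<open>Independence and identical distribution from test functions\<close>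

text \<open>The class of test functions: Lipschitz continuity makes \<open>t \<mapsto> E (g (D t))\<close> continuous for a
  stochastically continuous process, and the class approximates the indicators of half-lines.\<close>
definition bounded_lipschitz :: "(real \<Rightarrow> real) \<Rightarrow> bool" where
  "bounded_lipschitz g \<longleftrightarrow> (\<exists>L. L-lipschitz_on UNIV g) \<and> (\<forall>x. \<bar>g x\<bar> \<le> 1)"

lemma bounded_lipschitz_abs_le: "bounded_lipschitz g \<Longrightarrow> \<bar>g x\<bar> \<le> 1"
  by (simp add: bounded_lipschitz_def)

lemma bounded_lipschitz_continuous_on: "bounded_lipschitz g \<Longrightarrow> continuous_on UNIV g"
  by (auto simp: bounded_lipschitz_def intro: lipschitz_on_continuous_on)

lemma bounded_lipschitz_measurable: "bounded_lipschitz g \<Longrightarrow> g \<in> borel_measurable borel"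
  by (intro borel_measurable_continuous_onI bounded_lipschitz_continuous_on)

lemma bounded_lipschitz_1: "bounded_lipschitz (\<lambda>_. 1)"
  by (auto simp: bounded_lipschitz_def intro: lipschitz_on_constant)

definition ramp :: "nat \<Rightarrow> real \<Rightarrow> real \<Rightarrow> real" where
  "ramp m a x = max 0 (min 1 (1 + real m * (a - x)))"

lemma bounded_lipschitz_ramp: "bounded_lipschitz (ramp m a)"
proof -
  have "\<bar>ramp m a x - ramp m a y\<bar> \<le> real m * \<bar>x - y\<bar>" for x y
  proof -
    have "\<bar>ramp m a x - ramp m a y\<bar> \<le> \<bar>real m * (a - x) - real m * (a - y)\<bar>"
      unfolding ramp_def by linarith
    also have "\<dots> = \<bar>real m * (y - x)\<bar>" by (simp add: algebra_simps)
    finally show ?thesis by (simp add: abs_mult abs_minus_commute)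
  qed
  then have "(real m)-lipschitz_on UNIV (ramp m a)"
    by (intro lipschitz_onI) (auto simp: dist_real_def)
  moreover have "\<bar>ramp m a x\<bar> \<le> 1" for x unfolding ramp_def by linarith
  ultimately show ?thesis unfolding bounded_lipschitz_def by blast
qed

lemma ramp_tendsto_indicator: "(\<lambda>m. ramp m a x) \<longlonglongrightarrow> indicator {..a} x"
proof (cases "x \<le> a")
  case True
  then have "ramp m a x = 1" for m by (simp add: ramp_def)
  with True show ?thesis by simp
next
  case False
  obtain k :: nat where k: "1 / (x - a) < real k" using reals_Archimedean2 by blast
  have "ramp m a x = 0" if "k \<le> m" for m
  proof -
    have "1 / (x - a) < real m" using k that by linarith
    then have "1 < real m * (x - a)" using False by (simp add: divide_less_eq)
    then show ?thesis by (simp add: ramp_def algebra_simps)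
  qed
  then have "\<forall>\<^sub>F m in sequentially. ramp m a x = 0"
    unfolding eventually_sequentially by blast
  with False show ?thesis by (simp add: tendsto_eventually)
qed

lemma abs_prod_le_1: "\<bar>\<Prod>i\<in>K. f i\<bar> \<le> (1::real)" if "\<And>i. i \<in> K \<Longrightarrow> \<bar>f i\<bar> \<le> 1"
  unfolding abs_prod using that by (intro prod_le_1) auto

context prob_space
begin

lemma expectation_prod_ramp_tendsto:
  assumes [measurable]: "\<And>i. random_variable borel (J i)" and K: "finite K"
  shows "(\<lambda>m. expectation (\<lambda>\<omega>. \<Prod>i\<in>K. ramp m (a i) (J i \<omega>)))
    \<longlonglongrightarrow> prob {\<omega>\<in>space M. \<forall>i\<in>K. J i \<omega> \<le> a i}"
proof -
  note [measurable] = bounded_lipschitz_measurable[OF bounded_lipschitz_ramp]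
  have "(\<lambda>m. expectation (\<lambda>\<omega>. \<Prod>i\<in>K. ramp m (a i) (J i \<omega>)))
    \<longlonglongrightarrow> expectation (\<lambda>\<omega>. \<Prod>i\<in>K. indicator {..a i} (J i \<omega>))"
  proof (rule integral_dominated_convergence[where w = "\<lambda>_. 1"])
    show "AE \<omega> in M. norm (\<Prod>i\<in>K. ramp m (a i) (J i \<omega>)) \<le> 1" for m
      unfolding real_norm_def
      by (intro AE_I2 abs_prod_le_1 bounded_lipschitz_abs_le bounded_lipschitz_ramp)
  qed (auto intro!: tendsto_prod ramp_tendsto_indicator)
  also have "expectation (\<lambda>\<omega>. \<Prod>i\<in>K. indicat_real {..a i} (J i \<omega>))
      = expectation (indicat_real {\<omega>\<in>space M. \<forall>i\<in>K. J i \<omega> \<le> a i})"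
  proof (rule Bochner_Integration.integral_cong[OF refl])
    fix \<omega> assume "\<omega> \<in> space M"
    then show "(\<Prod>i\<in>K. indicator {..a i} (J i \<omega>)) = (indicator {\<omega>\<in>space M. \<forall>i\<in>K. J i \<omega> \<le> a i} \<omega> :: real)"
      using K by (cases "\<forall>i\<in>K. J i \<omega> \<le> a i") (auto intro!: prod.neutral simp: indicator_def)
  qed
  also have "\<dots> = prob {\<omega>\<in>space M. \<forall>i\<in>K. J i \<omega> \<le> a i}"
    by (auto intro!: arg_cong[where f = prob])
  finally show ?thesis .
qed

text \<open>Product expectations over test functions determine the joint distribution functions by
  approximation of indicators, and the half-lines form an intersection-stable generator. The same
  functional \<open>c\<close> for all indices makes the variables identically distributed. Test functions
  equal to 1 remove the indices outside a finite set \<open>K\<close>.\<close>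
lemma iid_if_expectation_prod:
  assumes rv [measurable]: "\<And>i. random_variable borel (J i)"
    and prod: "\<And>n g. (\<And>i. bounded_lipschitz (g i)) \<Longrightarrow>
      expectation (\<lambda>\<omega>. \<Prod>i<n. g i (J i \<omega>)) = (\<Prod>i<n. c (g i))"
  shows "iid J"
proof -
  have c1: "c (\<lambda>_. 1) = 1"
    using prod[of "\<lambda>_ _. 1" "Suc 0"] by (simp add: bounded_lipschitz_1 prob_space)
  have subprod: "expectation (\<lambda>\<omega>. \<Prod>i\<in>K. g i (J i \<omega>)) = (\<Prod>i\<in>K. c (g i))"
    if K: "finite K" and g: "\<And>i. bounded_lipschitz (g i)" for K g
  proof -
    obtain n where n: "K \<subseteq> {..<n}" using K unfolding finite_nat_iff_bounded by blast
    then have Kn: "{..<n} \<inter> K = K" by blast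
    define h where "h i = (if i \<in> K then g i else (\<lambda>_. 1))" for i
    have "expectation (\<lambda>\<omega>. \<Prod>i<n. h i (J i \<omega>)) = (\<Prod>i<n. c (h i))"
      by (rule prod) (simp add: h_def g bounded_lipschitz_1)
    moreover have "(\<Prod>i<n. h i (x i)) = (\<Prod>i\<in>K. g i (x i))" for x
      using prod.inter_restrict[of "{..<n}" "\<lambda>i. g i (x i)" K] unfolding Kn h_def
      by (simp add: if_distribR)
    moreover have "(\<Prod>i<n. c (h i)) = (\<Prod>i\<in>K. c (g i))"
      using prod.inter_restrict[of "{..<n}" "\<lambda>i. c (g i)" K] unfolding Kn h_def
      by (simp add: if_distrib[of c] c1 cong: if_cong)
    ultimately show ?thesis by simp
  qed
  have single: "(\<lambda>m. c (ramp m a)) \<longlonglongrightarrow> prob {\<omega>\<in>space M. J i \<omega> \<le> a}" for a i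
    using expectation_prod_ramp_tendsto[of J "{i}" "\<lambda>_. a"]
      subprod[of "{i}" "\<lambda>_. ramp m a" for m] by (simp add: bounded_lipschitz_ramp)
  have joint: "prob {\<omega>\<in>space M. \<forall>i\<in>K. J i \<omega> \<le> a i} = (\<Prod>i\<in>K. prob {\<omega>\<in>space M. J i \<omega> \<le> a i})"
    if "finite K" for K a
  proof (rule LIMSEQ_unique)
    show "(\<lambda>m. \<Prod>i\<in>K. c (ramp m (a i))) \<longlonglongrightarrow> (\<Prod>i\<in>K. prob {\<omega>\<in>space M. J i \<omega> \<le> a i})"
      by (intro tendsto_prod single)
    show "(\<lambda>m. \<Prod>i\<in>K. c (ramp m (a i))) \<longlonglongrightarrow> prob {\<omega>\<in>space M. \<forall>i\<in>K. J i \<omega> \<le> a i}"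
      using expectation_prod_ramp_tendsto[of J K a] that
        subprod[of K "\<lambda>i. ramp m (a i)" for m] by (simp add: bounded_lipschitz_ramp)
  qed
  let ?F = "\<lambda>i. {J i -` A \<inter> space M | A. A \<in> range atMost}"
  have F: "sigma_sets (space M) {J i -` A \<inter> space M | A. A \<in> sets borel} = sigma_sets (space M) (?F i)" for i
  proof -
    have "{J i -` A \<inter> space M | A. A \<in> sets borel} = sigma_sets (space M) (?F i)"
      using sigma_sets_vimage_commute[of "J i" "space M" UNIV "range atMost"]
      by (simp add: borel_eq_atMost)
    moreover have "?F i \<subseteq> Pow (space M)" by auto
    ultimately show ?thesis by (simp only: sigma_sets_sigma_sets_eq)
  qed
  have "indep_sets ?F UNIV"
  proof (rule indep_setsI)
    fix i show "?F i \<subseteq> events" by auto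
  next
    fix A and K :: "nat set" assume K: "K \<noteq> {}" "finite K" and "\<forall>i\<in>K. A i \<in> ?F i"
    then have "\<forall>i\<in>K. \<exists>a. A i = J i -` {..a} \<inter> space M" by auto
    then obtain a where a: "\<And>i. i \<in> K \<Longrightarrow> A i = {\<omega>\<in>space M. J i \<omega> \<le> a i}"
      unfolding bchoice_iff by (auto simp: vimage_def Int_def conj_commute)
    have "(\<Inter>i\<in>K. A i) = {\<omega>\<in>space M. \<forall>i\<in>K. J i \<omega> \<le> a i}"
      using K a by auto
    then show "prob (\<Inter>i\<in>K. A i) = (\<Prod>i\<in>K. prob (A i))"
      using joint[OF K(2), of a] a by simp
  qed
  moreover have "Int_stable (?F i)" for i
  proof (rule Int_stableI)
    fix A B assume "A \<in> ?F i" "B \<in> ?F i"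
    then obtain a b where "A = J i -` {..a} \<inter> space M" "B = J i -` {..b} \<inter> space M" by auto
    then have "A \<inter> B = J i -` {..min a b} \<inter> space M" by auto
    then show "A \<inter> B \<in> ?F i" by blast
  qed
  ultimately have "indep_vars (\<lambda>_. borel) J UNIV"
    unfolding indep_vars_def F by (auto intro: indep_sets_sigma)
  moreover have "distr M borel (J i) = distr M borel (J 0)" for i
  proof (rule cdf_unique)
    show "cdf (distr M borel (J i)) = cdf (distr M borel (J 0))"
    proof
      fix a
      have "prob {\<omega>\<in>space M. J i \<omega> \<le> a} = prob {\<omega>\<in>space M. J 0 \<omega> \<le> a}"
        using single single by (rule LIMSEQ_unique)
      then show "cdf (distr M borel (J i)) a = cdf (distr M borel (J 0)) a"
        by (simp add: cdf_def measure_distr vimage_def Int_def conj_commute)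
    qed
  qed (simp_all add: real_distribution_distr)
  ultimately show ?thesis unfolding iid_def by blast
qed

section \<open>Conditioning\<close>

text \<open>Conditioning on \<open>X\<close>: for independent \<open>X\<close> and \<open>Z\<close>, the joint law is a product measure.\<close>
lemma expectation_indep_var_Fubini:
  fixes \<phi> :: "'b \<Rightarrow> 'b \<Rightarrow> real"
  assumes indep: "indep_var S X T Z"
    and [measurable]: "(\<lambda>(x, z). \<phi> x z) \<in> borel_measurable (S \<Otimes>\<^sub>M T)"
    and bound: "\<And>x z. \<bar>\<phi> x z\<bar> \<le> 1"
  shows "expectation (\<lambda>\<omega>. \<phi> (X \<omega>) (Z \<omega>)) = expectation (\<lambda>\<omega>. expectation (\<lambda>\<eta>. \<phi> (X \<omega>) (Z \<eta>)))"
proof -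
  note [measurable] = indep_var_rv1[OF indep] indep_var_rv2[OF indep]
  interpret X: prob_space "distr M S X" by (rule prob_space_distr) simp
  interpret Z: prob_space "distr M T Z" by (rule prob_space_distr) simp
  interpret XZ: pair_prob_space "distr M S X" "distr M T Z" ..
  have eq: "distr M S X \<Otimes>\<^sub>M distr M T Z = distr M (S \<Otimes>\<^sub>M T) (\<lambda>\<omega>. (X \<omega>, Z \<omega>))"
    using indep unfolding indep_var_distribution_eq by simp
  have "expectation (\<lambda>\<omega>. \<phi> (X \<omega>) (Z \<omega>))
      = integral\<^sup>L (distr M (S \<Otimes>\<^sub>M T) (\<lambda>\<omega>. (X \<omega>, Z \<omega>))) (\<lambda>(x, z). \<phi> x z)"
    by (subst integral_distr) simp_all
  also have "\<dots> = (\<integral>x. \<integral>z. \<phi> x z \<partial>distr M T Z \<partial>distr M S X)"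
  proof -
    have "integrable (distr M S X \<Otimes>\<^sub>M distr M T Z) (\<lambda>(x, z). \<phi> x z)"
      by (rule XZ.integrable_const_bound[where B = 1]) (auto simp: bound)
    then show ?thesis
      unfolding eq[symmetric] using XZ.integral_fst'[of "\<lambda>(x, z). \<phi> x z"] by simp
  qed
  also have "\<dots> = expectation (\<lambda>\<omega>. \<integral>z. \<phi> (X \<omega>) z \<partial>distr M T Z)"
    by (rule integral_distr) simp_all
  also have "\<dots> = expectation (\<lambda>\<omega>. expectation (\<lambda>\<eta>. \<phi> (X \<omega>) (Z \<eta>)))"
  proof (rule Bochner_Integration.integral_cong[OF refl])
    fix \<omega> assume "\<omega> \<in> space M"
    then have [measurable]: "X \<omega> \<in> space S" using indep_var_rv1[OF indep] by (rule measurable_space[rotated])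
    show "(\<integral>z. \<phi> (X \<omega>) z \<partial>distr M T Z) = expectation (\<lambda>\<eta>. \<phi> (X \<omega>) (Z \<eta>))"
      by (rule integral_distr) simp_all
  qed
  finally show ?thesis .
qed

section \<open>Levy processes at deterministic times\<close>

lemma levy_process_rv: "levy_process D \<Longrightarrow> 0 \<le> t \<Longrightarrow> random_variable borel (D t)"
  unfolding levy_process_def by blast

text \<open>Independence factorizes the expectation; stationarity replaces each increment by the value of the
  process at the length of the time interval.\<close>
lemma levy_process_expectation_prod_increments:
  assumes D: "levy_process D"
    and u: "0 \<le> u 0" "\<And>i. u i \<le> u (Suc i)"
    and g: "\<And>i. bounded_lipschitz (g i)"
  shows "expectation (\<lambda>\<omega>. \<Prod>i<n. g i (D (u (Suc i)) \<omega> - D (u i) \<omega>))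
    = (\<Prod>i<n. expectation (\<lambda>\<omega>. g i (D (u (Suc i) - u i) \<omega>)))"
proof -
  have u_nonneg: "0 \<le> u i" for i
    using u(1) incseqD[OF incseq_SucI[of u, OF u(2)], of 0 i] by simp
  have [measurable]: "random_variable borel (D (u i))" "random_variable borel (D (u (Suc i) - u i))" for i
    using levy_process_rv[OF D] u_nonneg[of i] u(2)[of i] by auto
  note [measurable] = bounded_lipschitz_measurable[OF g]
  have "\<forall>(n::nat) u. 0 \<le> u 0 \<longrightarrow> (\<forall>i<n. u i \<le> u (Suc i)) \<longrightarrow>
        indep_vars (\<lambda>_. borel) (\<lambda>i \<omega>. D (u (Suc i)) \<omega> - D (u i) \<omega>) {..<n}"
    using D unfolding levy_process_def by (elim conjE)
  then have "indep_vars (\<lambda>_. borel) (\<lambda>i \<omega>. D (u (Suc i)) \<omega> - D (u i) \<omega>) {..<n}"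
    using u by blast
  then have "indep_vars (\<lambda>_. borel) (\<lambda>i \<omega>. g i (D (u (Suc i)) \<omega> - D (u i) \<omega>)) {..<n}"
    by (rule indep_vars_compose2) simp
  then have "expectation (\<lambda>\<omega>. \<Prod>i<n. g i (D (u (Suc i)) \<omega> - D (u i) \<omega>))
    = (\<Prod>i<n. expectation (\<lambda>\<omega>. g i (D (u (Suc i)) \<omega> - D (u i) \<omega>)))"
  proof (rule indep_vars_lebesgue_integral[rotated])
    show "integrable M (\<lambda>\<omega>. g i (D (u (Suc i)) \<omega> - D (u i) \<omega>))" for i
      by (rule integrable_const_bound[where B = 1]) (auto simp: bounded_lipschitz_abs_le[OF g])
  qed simp
  also have "\<dots> = (\<Prod>i<n. expectation (\<lambda>\<omega>. g i (D (u (Suc i) - u i) \<omega>)))"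
  proof (rule prod.cong[OF refl])
    fix i
    have "\<forall>s\<ge>0. \<forall>t\<ge>0. distr M borel (\<lambda>\<omega>. D (s + t) \<omega> - D s \<omega>) = distr M borel (D t)"
      using D unfolding levy_process_def by (elim conjE)
    from this[rule_format, of "u i" "u (Suc i) - u i"]
    have eq: "distr M borel (\<lambda>\<omega>. D (u (Suc i)) \<omega> - D (u i) \<omega>) = distr M borel (D (u (Suc i) - u i))"
      using u(2)[of i] u_nonneg[of i] by simp
    have "expectation (\<lambda>\<omega>. g i (D (u (Suc i)) \<omega> - D (u i) \<omega>))
        = integral\<^sup>L (distr M borel (\<lambda>\<omega>. D (u (Suc i)) \<omega> - D (u i) \<omega>)) (g i)"
      by (subst integral_distr) simp_all
    also have "\<dots> = expectation (\<lambda>\<omega>. g i (D (u (Suc i) - u i) \<omega>))"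
      unfolding eq by (subst integral_distr) simp_all
    finally show "expectation (\<lambda>\<omega>. g i (D (u (Suc i)) \<omega> - D (u i) \<omega>))
        = expectation (\<lambda>\<omega>. g i (D (u (Suc i) - u i) \<omega>))" .
  qed
  finally show ?thesis .
qed

text \<open>Truncation at 0 keeps the time in the domain of the process and yields a function that is
  continuous on the whole line.\<close>
definition mean_at :: "(real \<Rightarrow> 'a \<Rightarrow> real) \<Rightarrow> (real \<Rightarrow> real) \<Rightarrow> real \<Rightarrow> real" where
  "mean_at D g w = expectation (\<lambda>\<omega>. g (D (max 0 w) \<omega>))"

lemma abs_mean_at_le_1:
  assumes D: "levy_process D" and g: "bounded_lipschitz g"
  shows "\<bar>mean_at D g w\<bar> \<le> 1"
proof -
  note [measurable] = levy_process_rv[OF D] bounded_lipschitz_measurable[OF g]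
  have "integrable M (\<lambda>\<omega>. g (D (max 0 w) \<omega>))"
    by (rule integrable_const_bound[where B = 1]) (auto simp: bounded_lipschitz_abs_le[OF g])
  then have "\<bar>mean_at D g w\<bar> \<le> expectation (\<lambda>\<omega>. \<bar>g (D (max 0 w) \<omega>)\<bar>)"
    unfolding mean_at_def by (simp add: integral_abs_bound)
  also have "\<dots> \<le> expectation (\<lambda>_. 1)"
    by (rule integral_mono') (auto simp: bounded_lipschitz_abs_le[OF g])
  finally show ?thesis by (simp add: prob_space)
qed

text \<open>On the event that \<open>D s\<close> and \<open>D t\<close> differ by at most \<open>\<epsilon>\<close>, the values of \<open>g\<close> differ by at most
  \<open>L * \<epsilon>\<close>; the complement has small probability by stochastic continuity, and there \<open>\<bar>g\<bar> \<le> 1\<close>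
  bounds the difference by 2.\<close>
lemma continuous_on_mean_at:
  assumes D: "levy_process D" and g: "bounded_lipschitz g"
  shows "continuous_on UNIV (mean_at D g)"
proof -
  define h where "h t = expectation (\<lambda>\<omega>. g (D t \<omega>))" for t
  note [measurable] = levy_process_rv[OF D] bounded_lipschitz_measurable[OF g]
  obtain L where L: "L-lipschitz_on UNIV g" using g unfolding bounded_lipschitz_def by blast
  have L0: "0 \<le> L" using L by (rule lipschitz_on_nonneg)
  have diff: "\<bar>h s - h t\<bar> \<le> L * \<epsilon> + 2 * prob {\<omega>\<in>space M. \<epsilon> < \<bar>D s \<omega> - D t \<omega>\<bar>}"
    if st[measurable]: "0 \<le> s" "0 \<le> t" and \<epsilon>: "0 < \<epsilon>" for s t \<epsilon>
  proof -
    let ?A = "{\<omega>\<in>space M. \<epsilon> < \<bar>D s \<omega> - D t \<omega>\<bar>}"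
    have [measurable]: "random_variable borel (D s)" "random_variable borel (D t)"
      using levy_process_rv[OF D] st by auto
    have [simp]: "integrable M (\<lambda>\<omega>. g (D r \<omega>))" if "0 \<le> r" for r
      by (rule integrable_const_bound[where B = 1])
        (use that levy_process_rv[OF D] in \<open>auto simp: bounded_lipschitz_abs_le[OF g]\<close>)
    have le: "\<bar>g (D s \<omega>) - g (D t \<omega>)\<bar> \<le> L * \<epsilon> + 2 * indicator ?A \<omega>" if "\<omega> \<in> space M" for \<omega>
    proof (cases "\<omega> \<in> ?A")
      case True
      have "\<bar>g (D s \<omega>) - g (D t \<omega>)\<bar> \<le> 2"
        using bounded_lipschitz_abs_le[OF g, of "D s \<omega>"] bounded_lipschitz_abs_le[OF g, of "D t \<omega>"] by linarith
      moreover have "0 \<le> L * \<epsilon>" using L0 \<epsilon> by simp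
      ultimately show ?thesis using True by simp
    next
      case False
      have "\<bar>g (D s \<omega>) - g (D t \<omega>)\<bar> \<le> L * \<bar>D s \<omega> - D t \<omega>\<bar>"
        using lipschitz_onD[OF L, of "D s \<omega>" "D t \<omega>"] by (simp add: dist_real_def)
      also have "\<dots> \<le> L * \<epsilon>" using False that L0 by (intro mult_left_mono) auto
      finally show ?thesis using False by simp
    qed
    have "\<bar>h s - h t\<bar> = \<bar>expectation (\<lambda>\<omega>. g (D s \<omega>) - g (D t \<omega>))\<bar>"
      unfolding h_def using st by simp
    also have "\<dots> \<le> expectation (\<lambda>\<omega>. \<bar>g (D s \<omega>) - g (D t \<omega>)\<bar>)"
      using integral_abs_bound by blast
    also have "\<dots> \<le> expectation (\<lambda>\<omega>. L * \<epsilon> + 2 * indicator ?A \<omega>)"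
    proof (rule integral_mono)
      show "integrable M (\<lambda>\<omega>. \<bar>g (D s \<omega>) - g (D t \<omega>)\<bar>)" using st by simp
      show "integrable M (\<lambda>\<omega>. L * \<epsilon> + 2 * indicator ?A \<omega>)"
        by (intro Bochner_Integration.integrable_add integrable_mult_right integrable_const
            integrable_real_indicator) (auto simp: emeasure_eq_measure)
    qed (rule le)
    also have "\<dots> = L * \<epsilon> + 2 * prob ?A"
    proof -
      have "integrable M (indicat_real ?A)"
        by (rule integrable_real_indicator) (auto simp: emeasure_eq_measure)
      moreover have "?A \<inter> space M = ?A" by blast
      ultimately show ?thesis by (simp add: prob_space)
    qed
    finally show ?thesis .
  qed
  have "continuous_on {0..} h"
    unfolding continuous_on_def
  proof (intro ballI tendstoI)
    fix t e :: real assume "t \<in> {0..}" and e: "0 < e"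
    then have t: "0 \<le> t" by simp
    \<comment> \<open>Adding 1 avoids division by zero if the Lipschitz constant is 0.\<close>
    define \<epsilon> where "\<epsilon> = e / (2 * (L + 1))"
    have \<epsilon>: "0 < \<epsilon>" using e L0 by (simp add: \<epsilon>_def)
    have "L * \<epsilon> \<le> (L + 1) * \<epsilon>" using \<epsilon> by (intro mult_right_mono) auto
    also have "(L + 1) * \<epsilon> = e / 2" using L0 by (simp add: \<epsilon>_def field_simps)
    finally have L\<epsilon>: "L * \<epsilon> \<le> e / 2" .
    have "\<forall>t\<ge>0. \<forall>\<epsilon>>0.
        ((\<lambda>s. prob {\<omega> \<in> space M. \<epsilon> < \<bar>D s \<omega> - D t \<omega>\<bar>}) \<longlongrightarrow> 0) (at t within {0..})"
      using D unfolding levy_process_def by (elim conjE)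
    then have "((\<lambda>s. prob {\<omega> \<in> space M. \<epsilon> < \<bar>D s \<omega> - D t \<omega>\<bar>}) \<longlongrightarrow> 0) (at t within {0..})"
      using t \<epsilon> by blast
    then have "\<forall>\<^sub>F s in at t within {0..}. prob {\<omega> \<in> space M. \<epsilon> < \<bar>D s \<omega> - D t \<omega>\<bar>} < e / 4"
      by (rule order_tendstoD) (use e in simp)
    moreover have "\<forall>\<^sub>F s in at t within {0..}. s \<in> {0..}"
      by (simp add: eventually_at_filter)
    ultimately show "\<forall>\<^sub>F s in at t within {0..}. dist (h s) (h t) < e"
    proof eventually_elim
      case (elim s)
      then show ?case using diff[of s t \<epsilon>] t \<epsilon> L\<epsilon> by (simp add: dist_real_def)
    qed
  qed
  then have "continuous_on UNIV (\<lambda>w. h (max 0 w))"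
    by (rule continuous_on_compose2) (auto intro!: continuous_intros)
  then show ?thesis unfolding mean_at_def h_def .
qed

section \<open>Almost sure behaviour of the paths\<close>

text \<open>Almost every path is unbounded: the Laplace transform of \<open>D n\<close> at \<open>s\<close> is the \<open>n\<close>-th power
  of \<open>exp (- f s)\<close>, and \<open>f s\<close> is positive, being nonzero and the exponent of a nonnegative variable.\<close>
lemma AE_subordinator_path:
  assumes D: "levy_subordinator f D" and s: "0 < s" "f s \<noteq> 0"
  shows "AE \<omega> in M. subordinator_path (\<lambda>t. D t \<omega>)"
proof -
  have levy: "levy_process D" and mono: "AE \<omega> in M. mono_on {0..} (\<lambda>t. D t \<omega>)"
    and laplace: "\<And>t s. 0 \<le> t \<Longrightarrow> 0 < s \<Longrightarrow> expectation (\<lambda>\<omega>. exp (- s * D t \<omega>)) = exp (- t * f s)"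
    using D unfolding levy_subordinator_def by auto
  have start: "AE \<omega> in M. D 0 \<omega> = 0"
    using levy unfolding levy_process_def by (elim conjE)
  have cont: "AE \<omega> in M. \<forall>t\<ge>0. continuous (at_right t) (\<lambda>s. D s \<omega>) \<and>
        (0 < t \<longrightarrow> (\<exists>l. ((\<lambda>s. D s \<omega>) \<longlongrightarrow> l) (at_left t)))"
    using levy unfolding levy_process_def by (elim conjE)
  have [measurable]: "random_variable borel (D (real n))" for n
    using levy_process_rv[OF levy] by simp
  have exp_le_1: "AE \<omega> in M. exp (- (s * D (real n) \<omega>)) \<le> 1" for n
    using mono start
  proof eventually_elim
    case (elim \<omega>)
    then have "0 \<le> D (real n) \<omega>" using mono_onD[OF elim(1), of 0 "real n"] by simp
    then show ?case using s by simp
  qed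
  have int: "integrable M (\<lambda>\<omega>. exp (- (s * D (real n) \<omega>)))" for n
    by (rule integrable_const_bound[where B = 1]) (use exp_le_1[of n] in auto)
  have E: "expectation (\<lambda>\<omega>. exp (- (s * D (real n) \<omega>))) = exp (- f s) ^ n" for n
    using laplace[of "real n" s] s by (simp add: exp_of_nat_mult[symmetric])
  have "expectation (\<lambda>\<omega>. exp (- (s * D (real 1) \<omega>))) \<le> expectation (\<lambda>_. 1)"
    by (rule integral_mono_AE[OF int]) (use exp_le_1[of 1] in auto)
  then have "exp (- f s) \<le> 1" using E[of 1] by (simp add: prob_space)
  then have "exp (- f s) < 1" using s by simp
  then have "(\<lambda>n. expectation (\<lambda>\<omega>. exp (- (s * D (real n) \<omega>)))) \<longlonglongrightarrow> 0"
    unfolding E by (intro LIMSEQ_power_zero) simp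
  then have "AE \<omega> in M. \<forall>t. \<exists>n. t < s * D (real n) \<omega>"
    by (intro AE_unbounded_if_laplace_vanishes int) simp_all
  with mono start cont show ?thesis
  proof eventually_elim
    case (elim \<omega>)
    show ?case
    proof
      fix t
      obtain n where "s * t < s * D (real n) \<omega>" using elim(4) by blast
      then show "\<exists>x\<ge>0. t < D x \<omega>" using s by (intro exI[of _ "real n"]) simp
    qed (use elim in auto)
  qed
qed

text \<open>The Laplace transform of the \<open>n\<close>-th partial sum is the \<open>n\<close>-th power of that of one summand, which is
  less than 1 because the summand does not vanish almost surely.\<close>
lemma AE_partial_sums:
  fixes W :: "nat \<Rightarrow> 'a \<Rightarrow> real"
  assumes W: "iid W" and nonneg: "AE \<omega> in M. \<forall>i. 0 \<le> W i \<omega>"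
    and pos: "prob {\<omega>\<in>space M. W 0 \<omega> = 0} < 1"
  shows "AE \<omega> in M. incseq (\<lambda>n. \<Sum>i<n. W i \<omega>) \<and> (\<forall>t. \<exists>n. t < (\<Sum>i<n. W i \<omega>))"
proof -
  have indep: "indep_vars (\<lambda>_. borel) W UNIV" and distr: "\<And>i. distr M borel (W i) = distr M borel (W 0)"
    using W unfolding iid_def by auto
  have [measurable]: "random_variable borel (W i)" for i
    using indep unfolding indep_vars_def by simp
  define r where "r = expectation (\<lambda>\<omega>. exp (- W 0 \<omega>))"
  have exp_le_1: "AE \<omega> in M. exp (- W i \<omega>) \<le> 1" for i
    using nonneg by eventually_elim simp
  have int: "integrable M (\<lambda>\<omega>. exp (- W i \<omega>))" for i
    by (rule integrable_const_bound[where B = 1]) (use exp_le_1[of i] in auto)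
  have E: "expectation (\<lambda>\<omega>. exp (- W i \<omega>)) = r" for i
  proof -
    have "expectation (\<lambda>\<omega>. exp (- W j \<omega>)) = (\<integral>x. exp (- x) \<partial>distr M borel (W j))" for j
      by (subst integral_distr) simp_all
    then show ?thesis unfolding r_def using distr[of i] by simp
  qed
  have prod: "exp (- (\<Sum>i<n. W i \<omega>)) = (\<Prod>i<n. exp (- W i \<omega>))" for n \<omega>
    by (simp add: exp_sum sum_negf[symmetric])
  have indep_exp: "indep_vars (\<lambda>_. borel) (\<lambda>i \<omega>. exp (- W i \<omega>)) {..<n}" for n
    by (rule indep_vars_compose2[OF indep_vars_subset[OF indep]]) auto
  have E_sum: "expectation (\<lambda>\<omega>. exp (- (\<Sum>i<n. W i \<omega>))) = r ^ n" for n
    unfolding prod by (subst indep_vars_lebesgue_integral[OF _ indep_exp]) (simp_all add: int E)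
  have int_sum: "integrable M (\<lambda>\<omega>. exp (- (\<Sum>i<n. W i \<omega>)))" for n
    unfolding prod by (rule indep_vars_integrable[OF _ indep_exp]) (simp_all add: int)
  have "r < 1"
  proof (rule ccontr)
    assume "\<not> r < 1"
    moreover have "r \<le> expectation (\<lambda>_. 1)" unfolding r_def
      by (rule integral_mono_AE[OF int]) (use exp_le_1[of 0] in auto)
    ultimately have "expectation (\<lambda>\<omega>. 1 - exp (- W 0 \<omega>)) = 0"
      using int[of 0] by (simp add: r_def prob_space)
    then have "AE \<omega> in M. 1 - exp (- W 0 \<omega>) = 0"
      by (subst (asm) integral_nonneg_eq_0_iff_AE) (use int[of 0] exp_le_1[of 0] in auto)
    then have "AE \<omega> in M. \<omega> \<in> {\<omega>\<in>space M. W 0 \<omega> = 0}"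
      using AE_space by eventually_elim simp
    then have "prob {\<omega>\<in>space M. W 0 \<omega> = 0} = 1"
      by (subst prob_eq_1) auto
    with pos show False by simp
  qed
  moreover have "0 \<le> r" unfolding r_def by simp
  ultimately have "(\<lambda>n. expectation (\<lambda>\<omega>. exp (- (\<Sum>i<n. W i \<omega>)))) \<longlonglongrightarrow> 0"
    unfolding E_sum by (intro LIMSEQ_power_zero) simp
  then have "AE \<omega> in M. \<forall>t. \<exists>n. t < (\<Sum>i<n. W i \<omega>)"
    by (intro AE_unbounded_if_laplace_vanishes int_sum) simp_all
  with nonneg show ?thesis
  proof eventually_elim
    case (elim \<omega>)
    then show ?case by (auto intro!: incseq_SucI)
  qed
qed

section \<open>Variables generated by independent processes\<close>

lemma indep_set_commute: "indep_set A B \<Longrightarrow> indep_set B A"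
  unfolding indep_sets2_eq by (metis Int_commute mult.commute)

text \<open>The events generated by a process are the events of a \<open>\<sigma>\<close>-algebra, so that measurability with
  respect to the process can be stated as membership in a space of measurable functions.\<close>
lemma sets_sigma_generated_events:
  "sets (sigma (space M) (generated_events M A P)) = generated_events M A P"
  "sigma_sets (space M) (generated_events M A P) = generated_events M A P"
proof -
  let ?G = "{P t -` B \<inter> space M | t B. 0 \<le> t \<and> B \<in> sets A}"
  have G: "?G \<subseteq> Pow (space M)" by auto
  show closed: "sigma_sets (space M) (generated_events M A P) = generated_events M A P"
    unfolding generated_events_def by (rule sigma_sets_sigma_sets_eq[OF G])
  have "generated_events M A P \<subseteq> Pow (space M)"
    unfolding generated_events_def using sigma_sets_into_sp[OF G] by auto
  then show "sets (sigma (space M) (generated_events M A P)) = generated_events M A P"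
    using closed by (simp add: sets_measure_of)
qed

lemma indep_varI_generated_events:
  assumes "indep_processes A P B Q"
    and X: "X \<in> sigma (space M) (generated_events M A P) \<rightarrow>\<^sub>M S"
    and Z: "Z \<in> sigma (space M) (generated_events M B Q) \<rightarrow>\<^sub>M T"
  shows "indep_var S X T Z"
proof -
  have indep: "indep_set (generated_events M A P) (generated_events M B Q)"
    using assms(1) unfolding indep_processes_def .
  note * = sets_sigma_generated_events
  have rv: "V \<in> M \<rightarrow>\<^sub>M R" and preimages: "sigma_sets (space M) {V -` C \<inter> space M | C. C \<in> sets R} \<subseteq> generated_events M A' P'"
    if "generated_events M A' P' \<subseteq> events" "V \<in> sigma (space M) (generated_events M A' P') \<rightarrow>\<^sub>M R"
    for A' :: "'z measure" and P' V and R :: "'y measure"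
  proof -
    have pre: "V -` C \<inter> space M \<in> generated_events M A' P'" if "C \<in> sets R" for C
      using measurable_sets[OF \<open>V \<in> _\<close> that] *[where A = A' and P = P'] by (simp add: space_measure_of_conv)
    show "V \<in> M \<rightarrow>\<^sub>M R"
      using pre that measurable_space[OF that(2)] *[where A = A' and P = P']
      by (intro measurableI) (auto simp: space_measure_of_conv)
    have "sigma_sets (space M) {V -` C \<inter> space M | C. C \<in> sets R} \<subseteq> sigma_sets (space M) (generated_events M A' P')"
      using pre by (intro sigma_sets_mono') auto
    then show "sigma_sets (space M) {V -` C \<inter> space M | C. C \<in> sets R} \<subseteq> generated_events M A' P'"
      using *[where A = A' and P = P'] by simp
  qed
  show ?thesis
    unfolding indep_var_eq
  proof (intro conjI)
    show "indep_set (sigma_sets (space M) {X -` C \<inter> space M | C. C \<in> sets S})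
        (sigma_sets (space M) {Z -` C \<inter> space M | C. C \<in> sets T})"
      using indep preimages[OF indep_setD_ev1[OF indep] X] preimages[OF indep_setD_ev2[OF indep] Z]
      unfolding indep_sets2_eq by (meson subset_iff)
  qed (rule rv[OF indep_setD_ev1[OF indep] X] rv[OF indep_setD_ev2[OF indep] Z])+
qed

lemma generated_events_memI:
  assumes "0 \<le> t" "B \<in> sets A"
  shows "{\<omega>\<in>space M. P t \<omega> \<in> B} \<in> sets (sigma (space M) (generated_events M A P))"
  unfolding sets_sigma_generated_events unfolding generated_events_def
  by (rule sigma_sets.Basic) (use assms in \<open>auto simp: vimage_def Int_def conj_commute\<close>)

end

section \<open>Renewal processes time-changed by an inverse subordinator\<close>

lemma inverse_process_eq: "inverse_process D t \<omega> = right_inverse (\<lambda>x. D x \<omega>) t"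
  by (simp add: inverse_process_def right_inverse_def)

text \<open>The waiting times are general here: they are nonnegative and do not vanish almost surely. The
  Gamma distribution enters only at the end, through its tail. The number \<open>s\<^sub>0\<close> witnesses
  that the Bernstein function is not zero.\<close>
locale subordinated_renewal = prob_space M for M :: "'a measure" +
  fixes W :: "nat \<Rightarrow> 'a \<Rightarrow> real" and f :: "real \<Rightarrow> real" and D :: "real \<Rightarrow> 'a \<Rightarrow> real" and s\<^sub>0 :: real
  assumes W: "iid W"
    and W_nonneg: "AE \<omega> in M. \<forall>i. 0 \<le> W i \<omega>"
    and W_nonzero: "prob {\<omega>\<in>space M. W 0 \<omega> = 0} < 1"
    and D: "levy_subordinator f D"
    and s\<^sub>0: "0 < s\<^sub>0" "f s\<^sub>0 \<noteq> 0"
    and indep: "indep_processes (count_space UNIV) (renewal_count W) borel (inverse_process D)"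
begin

definition S :: "nat \<Rightarrow> 'a \<Rightarrow> real" where "S n \<omega> = (\<Sum>i<n. W i \<omega>)"

abbreviation Y :: "real \<Rightarrow> 'a \<Rightarrow> real" where "Y \<equiv> inverse_process D"

text \<open>The \<open>n\<close>-th renewal time of the time-changed process: the first time at which the inverse
  subordinator has reached the renewal time \<open>S n\<close>.\<close>
definition T :: "nat \<Rightarrow> 'a \<Rightarrow> real" where
  "T n \<omega> = first_passage (\<lambda>q. S n \<omega> \<le> Y q \<omega>)"

definition J :: "nat \<Rightarrow> 'a \<Rightarrow> real" where "J n \<omega> = T (Suc n) \<omega> - T n \<omega>"

text \<open>Only the counting process and the inverse subordinator are known to be independent. The next two
  definitions recover the renewal times from the former and the subordinator from the latter, so
  that the recovered versions are independent; they agree with the originals almost surely.\<close>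
definition S_of_N :: "nat \<Rightarrow> 'a \<Rightarrow> real" where
  "S_of_N n \<omega> = first_passage (\<lambda>q. n \<le> renewal_count W q \<omega>)"

definition D_of_Y :: "real \<Rightarrow> 'a \<Rightarrow> real" where
  "D_of_Y x \<omega> = first_passage (\<lambda>q. x < Y q \<omega>)"

lemma levy: "levy_process D"
  using D unfolding levy_subordinator_def by blast

lemma W_indep: "indep_vars (\<lambda>_. borel) W UNIV"
  and W_distr: "distr M borel (W i) = distr M borel (W 0)"
  using W unfolding iid_def by blast+

lemma measurable_W [measurable]: "random_variable borel (W i)"
  using W_indep unfolding indep_vars_def by simp

lemma measurable_S [measurable]: "random_variable borel (S n)"
  unfolding S_def by measurable

lemma measurable_Y [measurable]:
  assumes "0 \<le> t" shows "random_variable borel (Y t)"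
proof (rule measurableI)
  fix B :: "real set" assume "B \<in> sets borel"
  then have "{\<omega>\<in>space M. Y t \<omega> \<in> B} \<in> generated_events M borel Y"
    using generated_events_memI[OF assms, of B borel Y] by (simp add: sets_sigma_generated_events)
  then have "{\<omega>\<in>space M. Y t \<omega> \<in> B} \<in> events"
    using indep unfolding indep_processes_def by (auto dest: indep_setD_ev2)
  then show "Y t -` B \<inter> space M \<in> events"
    by (simp add: vimage_def Int_def conj_commute)
qed simp

lemma measurable_T [measurable]: "random_variable borel (T n)"
  unfolding T_def
proof (rule measurable_first_passage)
  fix q :: real assume "0 \<le> q"
  note [measurable] = measurable_Y[OF this]
  show "{\<omega>\<in>space M. S n \<omega> \<le> Y q \<omega>} \<in> events" by measurable
qed

lemma measurable_J [measurable]: "random_variable borel (J n)"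
  unfolding J_def by measurable

lemma measurable_count:
  assumes "0 \<le> t" shows "random_variable (count_space UNIV) (\<lambda>\<omega>. renewal_count W (Y t \<omega>) \<omega>)"
  unfolding renewal_count_def using measurable_Max_le[OF measurable_S measurable_Y[OF assms]]
  by (simp add: S_def)

lemma measurable_S_of_N_generated:
  "S_of_N n \<in> borel_measurable (sigma (space M) (generated_events M (count_space UNIV) (renewal_count W)))"
  unfolding S_of_N_def
proof (rule measurable_first_passage)
  fix q :: real assume "0 \<le> q"
  from generated_events_memI[OF this, of "{n..}" "count_space UNIV" "renewal_count W"]
  show "{\<omega> \<in> space (sigma (space M) (generated_events M (count_space UNIV) (renewal_count W))).
      n \<le> renewal_count W q \<omega>}
    \<in> sets (sigma (space M) (generated_events M (count_space UNIV) (renewal_count W)))"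
    by (simp add: space_measure_of_conv)
qed

lemma measurable_D_of_Y_generated: "D_of_Y x \<in> borel_measurable (sigma (space M) (generated_events M borel Y))"
  unfolding D_of_Y_def
proof (rule measurable_first_passage)
  fix q :: real assume "0 \<le> q"
  from generated_events_memI[OF this, of "{x<..}" borel Y]
  show "{\<omega> \<in> space (sigma (space M) (generated_events M borel Y)). x < Y q \<omega>}
    \<in> sets (sigma (space M) (generated_events M borel Y))"
    by (simp add: space_measure_of_conv)
qed

lemma measurable_Y_generated:
  assumes "0 \<le> t" shows "Y t \<in> borel_measurable (sigma (space M) (generated_events M borel Y))"
proof (rule measurableI)
  fix B :: "real set" assume "B \<in> sets borel"
  from generated_events_memI[OF assms this, of Y]
  show "Y t -` B \<inter> space (sigma (space M) (generated_events M borel Y))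
      \<in> sets (sigma (space M) (generated_events M borel Y))"
    by (simp add: space_measure_of_conv vimage_def Int_def conj_commute)
qed simp

lemma indep_var_S_of_N_D_of_Y:
  "indep_var (\<Pi>\<^sub>M n\<in>UNIV. borel) (\<lambda>\<omega> n. S_of_N n \<omega>) (\<Pi>\<^sub>M j\<in>UNIV. borel) (\<lambda>\<omega> j. D_of_Y (u j) \<omega>)"
  for u :: "nat \<Rightarrow> real"
  by (rule indep_varI_generated_events[OF indep])
    (rule measurable_PiM_single', auto intro: measurable_S_of_N_generated measurable_D_of_Y_generated)+

lemma indep_var_Y_S_of_N:
  assumes "0 \<le> t" shows "indep_var borel (Y t) borel (S_of_N n)"
proof (rule indep_varI_generated_events)
  show "indep_processes borel Y (count_space UNIV) (renewal_count W)"
    using indep unfolding indep_processes_def by (rule indep_set_commute)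
qed (rule measurable_Y_generated[OF assms] measurable_S_of_N_generated)+

lemma measurable_S_of_N [measurable]: "random_variable borel (S_of_N n)"
  using indep_var_rv2[OF indep_var_Y_S_of_N[of 0]] by simp

lemma measurable_D_of_Y [measurable]: "random_variable borel (D_of_Y x)"
  using measurable_compose[OF indep_var_rv2[OF indep_var_S_of_N_D_of_Y[of "\<lambda>_. x"]]
      measurable_component_singleton[of 0 UNIV]] by simp

lemma AE_paths:
  "AE \<omega> in M. subordinator_path (\<lambda>x. D x \<omega>) \<and> incseq (\<lambda>n. S n \<omega>) \<and> (\<forall>t. \<exists>n. t < S n \<omega>)
    \<and> S 0 \<omega> = 0"
  using AE_subordinator_path[OF D s\<^sub>0] AE_partial_sums[OF W W_nonneg W_nonzero]
  by eventually_elim (simp add: S_def)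

lemma S_nonneg: "incseq (\<lambda>n. S n \<omega>) \<Longrightarrow> 0 \<le> S n \<omega>"
  using incseqD[of "\<lambda>n. S n \<omega>" 0 n] by (simp add: S_def)

lemma AE_S_of_N: "AE \<omega> in M. \<forall>n. S_of_N n \<omega> = S n \<omega>"
  using AE_paths
proof eventually_elim
  case (elim \<omega>)
  then show ?case
    using first_passage_Max[of "\<lambda>n. S n \<omega>"] by (simp add: S_of_N_def renewal_count_def S_def)
qed

lemma AE_D_of_Y: "AE \<omega> in M. \<forall>x\<ge>0. D_of_Y x \<omega> = D x \<omega>"
  using AE_paths
proof eventually_elim
  case (elim \<omega>)
  then interpret subordinator_path "\<lambda>x. D x \<omega>" by blast
  show ?case using first_passage_recovers_path by (simp add: D_of_Y_def inverse_process_eq)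
qed

lemma AE_T_left_sup: "AE \<omega> in M. \<forall>n. T n \<omega> = left_sup (\<lambda>x. D x \<omega>) (S n \<omega>)"
  using AE_paths
proof eventually_elim
  case (elim \<omega>)
  then interpret subordinator_path "\<lambda>x. D x \<omega>" by blast
  show ?case using first_passage_right_inverse by (simp add: T_def inverse_process_eq)
qed

lemma AE_T: "AE \<omega> in M. (\<forall>n. \<forall>t\<ge>0. S n \<omega> \<le> Y t \<omega> \<longleftrightarrow> T n \<omega> \<le> t) \<and> T 0 \<omega> = 0 \<and> incseq (\<lambda>n. T n \<omega>)"
  using AE_paths AE_T_left_sup
proof eventually_elim
  case (elim \<omega>)
  then interpret subordinator_path "\<lambda>x. D x \<omega>" by blast
  show ?case
    using elim le_right_inverse_iff left_sup_0
    by (auto simp: inverse_process_eq incseq_def intro: left_sup_mono)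
qed

lemma sum_J: "T 0 \<omega> = 0 \<Longrightarrow> (\<Sum>i<n. J i \<omega>) = T n \<omega>"
  by (induction n) (simp_all add: J_def)

text \<open>The waiting times \<open>J\<close> sum up to \<open>T\<close>, and \<open>S n \<le> Y t\<close> holds exactly if \<open>T n \<le> t\<close>; so both counts are
  maxima of the same set.\<close>
lemma AE_renewal_count_J:
  "AE \<omega> in M. \<forall>t\<ge>0. renewal_count W (Y t \<omega>) \<omega> = renewal_count J t \<omega>"
  using AE_T
proof eventually_elim
  case (elim \<omega>)
  then have "\<And>n. (\<Sum>i<n. J i \<omega>) = T n \<omega>" and "\<And>n t. 0 \<le> t \<Longrightarrow> S n \<omega> \<le> Y t \<omega> \<longleftrightarrow> T n \<omega> \<le> t"
    using sum_J by blast+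
  then show ?case by (simp add: renewal_count_def flip: S_def)
qed

lemma AE_J_nonneg: "AE \<omega> in M. \<forall>i. 0 \<le> J i \<omega>"
  using AE_T by eventually_elim (simp add: J_def incseq_Suc_iff)

lemma AE_tendsto_T:
  "AE \<omega> in M. \<forall>n. (\<lambda>k. D_of_Y (grid_point k (S_of_N n \<omega>)) \<omega>) \<longlonglongrightarrow> T n \<omega>"
  using AE_paths AE_T_left_sup AE_S_of_N AE_D_of_Y
proof eventually_elim
  case (elim \<omega>)
  then interpret subordinator_path "\<lambda>x. D x \<omega>" by blast
  show ?case
    using grid_tendsto_left_sup[OF S_nonneg] elim by simp
qed

lemma measurable_grid_increment:
  "random_variable borel (\<lambda>\<omega>. grid_point k (S (Suc i) \<omega>) - grid_point k (S i \<omega>))"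
  by measurable

text \<open>Condition on the renewal times \<open>S\<close>, which are independent of \<open>D\<close> up to null sets. Given \<open>S\<close>, the
  grid points are fixed and nondecreasing, so the increments of the Levy process between them are
  independent. Since the grid is countable, the integrand is a measurable function of \<open>S\<close> and of
  a sequence of values of \<open>D\<close>, as the conditioning requires.\<close>
lemma expectation_prod_grid_increments:
  assumes g: "\<And>i. bounded_lipschitz (g i)"
  shows "expectation (\<lambda>\<omega>. \<Prod>i<n. g i (D_of_Y (grid_point k (S_of_N (Suc i) \<omega>)) \<omega> - D_of_Y (grid_point k (S_of_N i \<omega>)) \<omega>))
    = expectation (\<lambda>\<omega>. \<Prod>i<n. mean_at D (g i) (grid_point k (S (Suc i) \<omega>) - grid_point k (S i \<omega>)))"
proof -
  note [measurable] = bounded_lipschitz_measurable[OF g]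
  define \<phi> where "\<phi> x z = (\<Prod>i<n. g i (z (grid k (x (Suc i))) - z (grid k (x i))))"
    for x :: "nat \<Rightarrow> real" and z :: "nat \<Rightarrow> real"
  define u where "u j = real j / real (Suc k)" for j
  have [measurable]: "(\<lambda>(x, z). z (grid k (x m))) \<in>
      borel_measurable ((\<Pi>\<^sub>M n\<in>UNIV. borel) \<Otimes>\<^sub>M (\<Pi>\<^sub>M j\<in>UNIV. borel))"
    for m :: nat
  proof -
    have "(\<lambda>p. snd p (grid k (fst p m))) \<in>
      borel_measurable ((\<Pi>\<^sub>M n\<in>UNIV. (borel :: real measure)) \<Otimes>\<^sub>M (\<Pi>\<^sub>M j\<in>UNIV. (borel :: real measure)))"
      by (rule measurable_compose_countable) measurable
    then show ?thesis by (simp add: case_prod_beta')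
  qed
  have \<phi>_measurable: "(\<lambda>(x, z). \<phi> x z) \<in>
      borel_measurable ((\<Pi>\<^sub>M n\<in>UNIV. borel) \<Otimes>\<^sub>M (\<Pi>\<^sub>M j\<in>UNIV. borel))"
    unfolding \<phi>_def by measurable
  \<comment> \<open>The point \<open>u j\<close> of the grid is the time with index \<open>j\<close>, so \<open>\<phi>\<close> sees the subordinator as a sequence.\<close>
  have "expectation (\<lambda>\<omega>. \<phi> (\<lambda>n. S_of_N n \<omega>) (\<lambda>j. D_of_Y (u j) \<omega>))
      = expectation (\<lambda>\<omega>. expectation (\<lambda>\<eta>. \<phi> (\<lambda>n. S_of_N n \<omega>) (\<lambda>j. D_of_Y (u j) \<eta>)))"
    by (rule expectation_indep_var_Fubini[OF indep_var_S_of_N_D_of_Y \<phi>_measurable])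
      (simp only: \<phi>_def, intro abs_prod_le_1 bounded_lipschitz_abs_le g)
  also have "\<dots> = expectation (\<lambda>\<omega>. \<Prod>i<n. mean_at D (g i) (grid_point k (S (Suc i) \<omega>) - grid_point k (S i \<omega>)))"
  proof (rule integral_cong_AE)
    show "AE \<omega> in M. expectation (\<lambda>\<eta>. \<phi> (\<lambda>n. S_of_N n \<omega>) (\<lambda>j. D_of_Y (u j) \<eta>))
        = (\<Prod>i<n. mean_at D (g i) (grid_point k (S (Suc i) \<omega>) - grid_point k (S i \<omega>)))"
      using AE_paths AE_S_of_N
    proof eventually_elim
      case (elim \<omega>)
      define v where "v i = grid_point k (S i \<omega>)" for i
      have v: "0 \<le> v 0" "v i \<le> v (Suc i)" for i
        unfolding v_def using elim
        by (auto intro!: divide_right_mono grid_mono simp: incseq_Suc_iff)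
      have v_nonneg: "0 \<le> v i" for i unfolding v_def by simp
      have rv: "random_variable borel (\<lambda>\<eta>. \<Prod>i<n. g i (B (v (Suc i)) \<eta> - B (v i) \<eta>))"
        if "\<And>i. random_variable borel (B (v i))" for B
        by (intro borel_measurable_prod measurable_compose[OF _ bounded_lipschitz_measurable[OF g]]
            borel_measurable_diff that)
      have "expectation (\<lambda>\<eta>. \<phi> (\<lambda>n. S_of_N n \<omega>) (\<lambda>j. D_of_Y (u j) \<eta>))
        = expectation (\<lambda>\<eta>. \<Prod>i<n. g i (D_of_Y (v (Suc i)) \<eta> - D_of_Y (v i) \<eta>))"
        using elim by (simp add: \<phi>_def u_def v_def)
      also have "\<dots> = expectation (\<lambda>\<eta>. \<Prod>i<n. g i (D (v (Suc i)) \<eta> - D (v i) \<eta>))"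
      proof (rule integral_cong_AE)
        show "AE \<eta> in M. (\<Prod>i<n. g i (D_of_Y (v (Suc i)) \<eta> - D_of_Y (v i) \<eta>))
            = (\<Prod>i<n. g i (D (v (Suc i)) \<eta> - D (v i) \<eta>))"
          using AE_D_of_Y by eventually_elim (simp add: v_nonneg)
      qed (rule rv, rule measurable_D_of_Y levy_process_rv[OF levy v_nonneg])+
      also have "\<dots> = (\<Prod>i<n. expectation (\<lambda>\<omega>. g i (D (v (Suc i) - v i) \<omega>)))"
        by (rule levy_process_expectation_prod_increments[OF levy v g])
      also have "\<dots> = (\<Prod>i<n. mean_at D (g i) (v (Suc i) - v i))"
        using v(2) by (simp add: mean_at_def max_def)
      finally show ?case unfolding v_def .
    qed
    show "(\<lambda>\<omega>. \<Prod>i<n. mean_at D (g i) (grid_point k (S (Suc i) \<omega>) - grid_point k (S i \<omega>))) \<in> borel_measurable M"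
      by (rule borel_measurable_prod, rule measurable_compose[OF measurable_grid_increment])
        (rule borel_measurable_continuous_onI[OF continuous_on_mean_at[OF levy g]])
    show "(\<lambda>\<omega>. expectation (\<lambda>\<eta>. \<phi> (\<lambda>n. S_of_N n \<omega>) (\<lambda>j. D_of_Y (u j) \<eta>))) \<in> borel_measurable M"
    proof (rule borel_measurable_lebesgue_integral)
      have 1: "(\<lambda>p n. S_of_N n (fst p)) \<in> M \<Otimes>\<^sub>M M \<rightarrow>\<^sub>M (\<Pi>\<^sub>M n\<in>UNIV. borel)"
        using indep_var_rv1[OF indep_var_S_of_N_D_of_Y[of u]] by (rule measurable_compose[OF measurable_fst])
      have 2: "(\<lambda>p j. D_of_Y (u j) (snd p)) \<in> M \<Otimes>\<^sub>M M \<rightarrow>\<^sub>M (\<Pi>\<^sub>M j\<in>UNIV. borel)"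
        using indep_var_rv2[OF indep_var_S_of_N_D_of_Y[of u]] by (rule measurable_compose[OF measurable_snd])
      have "(\<lambda>p. (\<lambda>(x, z). \<phi> x z) (\<lambda>n. S_of_N n (fst p), \<lambda>j. D_of_Y (u j) (snd p))) \<in> borel_measurable (M \<Otimes>\<^sub>M M)"
        using measurable_Pair[OF 1 2] \<phi>_measurable by (rule measurable_compose)
      then show "(\<lambda>(\<omega>, \<eta>). \<phi> (\<lambda>n. S_of_N n \<omega>) (\<lambda>j. D_of_Y (u j) \<eta>)) \<in> borel_measurable (M \<Otimes>\<^sub>M M)"
        unfolding case_prod_beta' fst_conv snd_conv .
    qed
  qed
  finally show ?thesis by (simp add: \<phi>_def u_def)
qed

text \<open>Refine the grid: on the left the increments converge to the waiting times \<open>J\<close>, on the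
  right the lengths of the grid intervals converge to the waiting times \<open>W\<close>, which are i.i.d.\<close>
lemma expectation_prod_J:
  assumes g: "\<And>i. bounded_lipschitz (g i)"
  shows "expectation (\<lambda>\<omega>. \<Prod>i<n. g i (J i \<omega>)) = (\<Prod>i<n. expectation (\<lambda>\<omega>. mean_at D (g i) (W 0 \<omega>)))"
proof -
  note [measurable] = bounded_lipschitz_measurable[OF g]
    borel_measurable_continuous_onI[OF continuous_on_mean_at[OF levy g]]
  note g_cont = bounded_lipschitz_continuous_on[OF g]
  note mean_cont = continuous_on_mean_at[OF levy g]
  let ?L = "\<lambda>k \<omega>. \<Prod>i<n. g i (D_of_Y (grid_point k (S_of_N (Suc i) \<omega>)) \<omega> - D_of_Y (grid_point k (S_of_N i \<omega>)) \<omega>)"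
  let ?R = "\<lambda>k \<omega>. \<Prod>i<n. mean_at D (g i) (grid_point k (S (Suc i) \<omega>) - grid_point k (S i \<omega>))"
  have [measurable]: "random_variable borel (\<lambda>\<omega>. D_of_Y (grid_point k (S_of_N i \<omega>)) \<omega>)" for k i
    by (rule measurable_compose_countable[of "\<lambda>j. D_of_Y (real j / real (Suc k))" M borel "\<lambda>\<omega>. grid k (S_of_N i \<omega>)"])
      measurable
  have "(\<lambda>k. expectation (?L k)) \<longlonglongrightarrow> expectation (\<lambda>\<omega>. \<Prod>i<n. g i (J i \<omega>))"
  proof (rule integral_dominated_convergence[where w = "\<lambda>_. 1"])
    show "AE \<omega> in M. (\<lambda>k. ?L k \<omega>) \<longlonglongrightarrow> (\<Prod>i<n. g i (J i \<omega>))"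
      using AE_tendsto_T
    proof eventually_elim
      case (elim \<omega>)
      show ?case unfolding J_def
        by (intro tendsto_prod continuous_on_tendsto_compose[OF g_cont] tendsto_diff)
          (use elim in auto)
    qed
    show "AE \<omega> in M. norm (?L k \<omega>) \<le> 1" for k
      unfolding real_norm_def by (intro AE_I2 abs_prod_le_1 bounded_lipschitz_abs_le g)
  qed auto
  moreover have "(\<lambda>k. expectation (?R k)) \<longlonglongrightarrow> expectation (\<lambda>\<omega>. \<Prod>i<n. mean_at D (g i) (W i \<omega>))"
  proof (rule integral_dominated_convergence[where w = "\<lambda>_. 1"])
    show "AE \<omega> in M. (\<lambda>k. ?R k \<omega>) \<longlonglongrightarrow> (\<Prod>i<n. mean_at D (g i) (W i \<omega>))"
      using AE_paths
    proof eventually_elim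
      case (elim \<omega>)
      have W_eq: "W i \<omega> = S (Suc i) \<omega> - S i \<omega>" for i by (simp add: S_def)
      show ?case unfolding W_eq
        by (intro tendsto_prod continuous_on_tendsto_compose[OF mean_cont] tendsto_diff
            grid_point_tendsto S_nonneg) (use elim in auto)
    qed
    show "AE \<omega> in M. norm (?R k \<omega>) \<le> 1" for k
      unfolding real_norm_def by (intro AE_I2 abs_prod_le_1 abs_mean_at_le_1 levy g)
  qed auto
  ultimately have "expectation (\<lambda>\<omega>. \<Prod>i<n. g i (J i \<omega>)) = expectation (\<lambda>\<omega>. \<Prod>i<n. mean_at D (g i) (W i \<omega>))"
    unfolding expectation_prod_grid_increments[OF g] by (rule LIMSEQ_unique)
  also have "\<dots> = (\<Prod>i<n. expectation (\<lambda>\<omega>. mean_at D (g i) (W i \<omega>)))"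
  proof (rule indep_vars_lebesgue_integral)
    show "indep_vars (\<lambda>_. borel) (\<lambda>i \<omega>. mean_at D (g i) (W i \<omega>)) {..<n}"
      by (rule indep_vars_compose2[OF indep_vars_subset[OF W_indep]]) auto
    show "integrable M (\<lambda>\<omega>. mean_at D (g i) (W i \<omega>))" for i
      by (rule integrable_const_bound[where B = 1]) (auto simp: abs_mean_at_le_1[OF levy g])
  qed simp
  also have "\<dots> = (\<Prod>i<n. expectation (\<lambda>\<omega>. mean_at D (g i) (W 0 \<omega>)))"
  proof (rule prod.cong[OF refl])
    fix i
    have "expectation (\<lambda>\<omega>. mean_at D (g i) (W j \<omega>)) = integral\<^sup>L (distr M borel (W j)) (mean_at D (g i))" for j
      by (subst integral_distr) simp_all
    then show "expectation (\<lambda>\<omega>. mean_at D (g i) (W i \<omega>)) = expectation (\<lambda>\<omega>. mean_at D (g i) (W 0 \<omega>))"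
      using W_distr[of i] by simp
  qed
  finally show ?thesis .
qed

lemma iid_J: "iid J"
  by (rule iid_if_expectation_prod[OF measurable_J expectation_prod_J])

lemma prob_eq_expectation_if:
  "prob {\<omega>\<in>space M. Q \<omega>} = expectation (\<lambda>\<omega>. if Q \<omega> then 1 else 0)"
proof -
  have "expectation (\<lambda>\<omega>. if Q \<omega> then 1 else 0) = expectation (indicat_real {\<omega>\<in>space M. Q \<omega>})"
    by (rule Bochner_Integration.integral_cong) (auto simp: indicator_def)
  also have "\<dots> = prob {\<omega>\<in>space M. Q \<omega>}"
    by (auto intro!: arg_cong[where f = prob])
  finally show ?thesis by (rule sym)
qed

text \<open>The first renewal is later than \<open>t\<close> exactly if \<open>W 0\<close> exceeds \<open>Y t\<close>; condition on \<open>Y t\<close>. The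
  other waiting times have the same distribution.\<close>
lemma prob_J_greater:
  assumes t: "0 \<le> t"
  shows "prob {\<omega>\<in>space M. t < J n \<omega>} = expectation (\<lambda>\<omega>. prob {\<eta>\<in>space M. Y t \<omega> < W 0 \<eta>})"
proof -
  note [measurable] = measurable_Y[OF t]
  have "prob {\<omega>\<in>space M. t < J n \<omega>} = prob {\<omega>\<in>space M. t < J 0 \<omega>}"
  proof -
    have "prob {\<omega>\<in>space M. t < J i \<omega>} = measure (distr M borel (J i)) {t<..}" for i
      by (subst measure_distr) (auto intro!: arg_cong[where f = prob])
    then show ?thesis using iid_J unfolding iid_def by metis
  qed
  also have "\<dots> = prob {\<omega>\<in>space M. Y t \<omega> < S_of_N 1 \<omega>}"
  proof (rule measure_eq_AE)
    show "AE \<omega> in M. \<omega> \<in> {\<omega>\<in>space M. t < J 0 \<omega>} \<longleftrightarrow> \<omega> \<in> {\<omega>\<in>space M. Y t \<omega> < S_of_N 1 \<omega>}"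
      using AE_T AE_S_of_N
    proof eventually_elim
      case (elim \<omega>)
      then have "S 1 \<omega> \<le> Y t \<omega> \<longleftrightarrow> T 1 \<omega> \<le> t" using t by blast
      then show ?case using elim by (auto simp: J_def not_le[symmetric])
    qed
  qed measurable
  also have "\<dots> = expectation (\<lambda>\<omega>. if Y t \<omega> < S_of_N 1 \<omega> then 1 else 0)"
    by (rule prob_eq_expectation_if)
  also have "\<dots> = expectation (\<lambda>\<omega>. expectation (\<lambda>\<eta>. if Y t \<omega> < S_of_N 1 \<eta> then 1 else 0))"
  proof (rule expectation_indep_var_Fubini[OF indep_var_Y_S_of_N[OF t]])
    show "(\<lambda>(y, x). if y < x then 1 else 0) \<in> borel_measurable (borel \<Otimes>\<^sub>M (borel :: real measure))"
      unfolding case_prod_beta' by measurable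
  qed simp
  also have "\<dots> = expectation (\<lambda>\<omega>. prob {\<eta>\<in>space M. Y t \<omega> < W 0 \<eta>})"
  proof (rule Bochner_Integration.integral_cong[OF refl])
    fix \<omega>
    have "expectation (\<lambda>\<eta>. if Y t \<omega> < S_of_N 1 \<eta> then 1 else 0) = prob {\<eta>\<in>space M. Y t \<omega> < S_of_N 1 \<eta>}"
      by (rule prob_eq_expectation_if[symmetric])
    also have "\<dots> = prob {\<eta>\<in>space M. Y t \<omega> < W 0 \<eta>}"
    proof (rule measure_eq_AE)
      show "AE \<eta> in M. \<eta> \<in> {\<eta>\<in>space M. Y t \<omega> < S_of_N 1 \<eta>} \<longleftrightarrow> \<eta> \<in> {\<eta>\<in>space M. Y t \<omega> < W 0 \<eta>}"
        using AE_S_of_N by eventually_elim (simp add: S_def)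
    qed measurable
    finally show "expectation (\<lambda>\<eta>. if Y t \<omega> < S_of_N 1 \<eta> then 1 else 0)
        = prob {\<eta>\<in>space M. Y t \<omega> < W 0 \<eta>}" .
  qed
  finally show ?thesis .
qed

lemma AE_Y_nonneg: "AE \<omega> in M. 0 \<le> Y t \<omega>"
  using AE_paths by eventually_elim (simp add: inverse_process_eq subordinator_path.right_inverse_nonneg)

lemma renewal_process_J:
  assumes "0 < prob {\<omega>\<in>space M. 0 < J 0 \<omega>}"
  shows "renewal_process (\<lambda>t \<omega>. renewal_count W (Y t \<omega>) \<omega>) J"
proof -
  have "prob {\<omega>\<in>space M. J 0 \<omega> = 0} \<le> prob (space M - {\<omega>\<in>space M. 0 < J 0 \<omega>})"
    by (rule finite_measure_mono) auto
  also have "\<dots> < 1" using assms by (subst prob_compl) auto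
  finally show ?thesis
    unfolding renewal_process_def
    using measurable_count iid_J AE_J_nonneg AE_renewal_count_J by blast
qed

end

section \<open>Gamma distributed waiting times\<close>

lemma erlang_1_tail:
  assumes "prob_space M" "distributed M lborel X (\<lambda>x. ennreal (erlang_density 1 lam x))"
    and "0 < lam" "0 \<le> y"
  shows "measure M {\<omega>\<in>space M. y < X \<omega>} = (1 + lam * y) * exp (- lam * y)"
proof -
  interpret prob_space M by fact
  have "measure M {\<omega>\<in>space M. y < X \<omega>} = 1 - erlang_CDF 1 lam y"
    using assms by (intro erlang_distributed_gt)
  also have "\<dots> = (1 + lam * y) * exp (- lam * y)"
    using assms by (simp add: erlang_CDF_def algebra_simps)
  finally show ?thesis .
qed

theorem theorem5p4:
  fixes M :: "'a measure" and lam :: real and f :: "real \<Rightarrow> real"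
    and W :: "nat \<Rightarrow> 'a \<Rightarrow> real" and D Y :: "real \<Rightarrow> 'a \<Rightarrow> real"
    and N Nf :: "real \<Rightarrow> 'a \<Rightarrow> nat"
  assumes "prob_space M"
    and "0 < lam"
    and "prob_space.iid M W"
    and "\<And>i. distributed M lborel (W i) (\<lambda>x. ennreal (erlang_density 1 lam x))"
    and "N = renewal_count W"
    and "prob_space.levy_subordinator M f D"
    and "\<exists>s>0. f s \<noteq> 0"
    and "Y = inverse_process D"
    and "prob_space.indep_processes M (count_space UNIV) N borel Y"
    and "Nf = (\<lambda>t \<omega>. N (Y t \<omega>) \<omega>)"
  shows "\<exists>J. prob_space.renewal_process M Nf J \<and>
    (\<forall>n. \<forall>t\<ge>0. measure M {\<omega> \<in> space M. J n \<omega> > t} =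
       integral\<^sup>L M (\<lambda>\<omega>. (1 + lam * Y t \<omega>) * exp (- lam * Y t \<omega>)))"
proof -
  interpret prob_space M by fact
  obtain s\<^sub>0 where s\<^sub>0: "0 < s\<^sub>0" "f s\<^sub>0 \<noteq> 0" using assms(7) by blast
  note tail = erlang_1_tail[OF assms(1) assms(4) assms(2)]
  have [measurable]: "random_variable borel (W i)" for i
    using distributed_measurable[OF assms(4)[of i]] by simp
  have W_pos: "AE \<omega> in M. 0 < W i \<omega>" for i
  proof -
    have "prob {\<omega>\<in>space M. 0 < W i \<omega>} = 1" using tail[of 0 i] by simp
    then show ?thesis by (subst (asm) prob_Collect_eq_1) auto
  qed
  interpret R: subordinated_renewal M W f D s\<^sub>0
  proof
    show "iid W" "levy_subordinator f D" using assms by simp_all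
    show "AE \<omega> in M. \<forall>i. 0 \<le> W i \<omega>"
      unfolding AE_all_countable
    proof
      show "AE \<omega> in M. 0 \<le> W i \<omega>" for i using W_pos[of i] by eventually_elim simp
    qed
    have "AE \<omega> in M. \<omega> \<notin> {\<omega>\<in>space M. W 0 \<omega> = 0}" using W_pos[of 0] by eventually_elim simp
    then have "prob {\<omega>\<in>space M. W 0 \<omega> = 0} = 0" by (subst prob_eq_0) auto
    then show "prob {\<omega>\<in>space M. W 0 \<omega> = 0} < 1" by simp
    show "indep_processes (count_space UNIV) (renewal_count W) borel (inverse_process D)"
      using assms by simp
  qed (use s\<^sub>0 in auto)
  have prob_J: "prob {\<omega>\<in>space M. t < R.J n \<omega>} = expectation (\<lambda>\<omega>. (1 + lam * Y t \<omega>) * exp (- lam * Y t \<omega>))"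
    if t: "0 \<le> t" for n t
  proof -
    note [measurable] = R.measurable_Y[OF t]
    have "prob {\<omega>\<in>space M. t < R.J n \<omega>} = expectation (\<lambda>\<omega>. prob {\<eta>\<in>space M. Y t \<omega> < W 0 \<eta>})"
      using R.prob_J_greater[OF t] assms by simp
    also have "\<dots> = expectation (\<lambda>\<omega>. (1 + lam * Y t \<omega>) * exp (- lam * Y t \<omega>))"
    proof (rule integral_cong_AE)
      show "AE \<omega> in M. prob {\<eta>\<in>space M. Y t \<omega> < W 0 \<eta>} = (1 + lam * Y t \<omega>) * exp (- lam * Y t \<omega>)"
        using R.AE_Y_nonneg[of t] by eventually_elim (use tail assms in simp)
    qed (simp_all add: assms(8))
    finally show ?thesis .
  qed
  \<comment> \<open>The integrand of the tail formula at time 0 is positive almost surely, hence so is its integral.\<close>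
  have "0 < prob {\<omega>\<in>space M. 0 < R.J 0 \<omega>}"
  proof (rule ccontr)
    note [measurable] = R.measurable_Y[OF order_refl]
    let ?h = "\<lambda>\<omega>. (1 + lam * Y 0 \<omega>) * exp (- lam * Y 0 \<omega>)"
    have Y_nonneg: "AE \<omega> in M. 0 \<le> lam * Y 0 \<omega>"
      using R.AE_Y_nonneg[of 0] by eventually_elim (use assms in simp)
    have pos: "AE \<omega> in M. 0 < ?h \<omega>" using Y_nonneg by eventually_elim simp
    have "AE \<omega> in M. norm (?h \<omega>) \<le> 1"
      using Y_nonneg
    proof eventually_elim
      case (elim \<omega>)
      have "?h \<omega> \<le> exp (lam * Y 0 \<omega>) * exp (- lam * Y 0 \<omega>)"
        by (intro mult_right_mono) simp_all
      then show ?case using elim by (simp add: exp_minus)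
    qed
    then have int: "integrable M ?h"
      by (intro integrable_const_bound[where B = 1]) (simp_all add: assms(8))
    assume "\<not> 0 < prob {\<omega>\<in>space M. 0 < R.J 0 \<omega>}"
    then have "prob {\<omega>\<in>space M. 0 < R.J 0 \<omega>} = 0"
      using measure_nonneg[of M "{\<omega>\<in>space M. 0 < R.J 0 \<omega>}"] by linarith
    then have "expectation ?h = 0" using prob_J[of 0 0] by simp
    moreover have "AE \<omega> in M. 0 \<le> ?h \<omega>" using pos by eventually_elim simp
    ultimately have "AE \<omega> in M. ?h \<omega> = 0"
      using integral_nonneg_eq_0_iff_AE[OF int] by blast
    then have "AE \<omega> in M. \<not> 0 < ?h \<omega>" by eventually_elim simp
    with pos show False by (rule AE_contr)
  qed
  then have "renewal_process Nf R.J" using R.renewal_process_J assms by simp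
  with prob_J show ?thesis by blast
qed

end
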